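(* Let $(\Omega,\mathcal{A},\mu)$ be a measure space with a $\sigma$-finite non-trivial diffuse measure $\mu$, and let $N=N(u)$ be a Young function which is continuous and strictly increasing on $[0,\infty)$. Then the Orlicz space $Or(N)$ over $(\Omega,\mathcal{A},\mu)$, equipped with the Luxemburg norm $$\|\xi\|_{Or(N)}=\inf\Big\{k>0:\ \int_\Omega N\Big(\frac{|\xi(\omega)|}{k}\Big)\,\mu(d\omega)\le 1\Big\},$$ is a regular rearrangement invariant space. Moreover, if the Luxemburg norm is replaced by an equivalent rearrangement invariant norm, the resulting space is weak regular.
   Context: A measure $\mu$ is called diffuse if every measurable set $B$ has a measurable subset $D$ with $\mu(D)=\mu(B)/2$. For a measurable a.e. finite $\xi:\Omega\to\mathbb{R}$ the tail function is $T_\xi(t)=\mu\{\omega:|\xi(\omega)|\ge t\}$, $t>0$. For a rearrangement invariant (r.i.) space $(F,\|\cdot\|_F)$ over $(\Omega,\mathcal{A},\mu)$, its Tchebychev characteristic is $$T^{(F)}(t)=\sup_{\xi\in F,\ \|\xi\|_F=1}T_\xi(t),\quad t>0,$$ and its fundamental function is $$\phi_F(\delta)=\sup_{D:\ \mu(D)\le\delta}\|I(D)\|_F,\quad \delta>0,$$ where $I(D)$ is the indicator function of the measurable set $D$. Let $g_F(s)=1/\phi_F(1/s)$ and let $g_F^{-1}$ denote its inverse function (if $g_F$ is not strictly monotone, the left inverse $g_F^{-1}(t)=\inf\{s>0: g_F(s)\ge t\}$), with the convention $1/0=\infty$. The space $F$ is called regular if there is $t_0>0$ such that $$g_F^{-1}(t)=\frac{1}{T^{(F)}(t)}\quad\text{for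 all } t>t_0 .$$ It is called weak regular if there is $t_0>0$ such that $g_F^{-1}(t)\asymp 1/T^{(F)}(t)$ for $t>t_0$, where $\asymp$ means that the ratio is bounded above and below by positive constants independent of $t$. *)

theory Defs
  imports "HOL-Analysis.Analysis"
begin

text \<open>
  Elements of a function space over a measure space are represented by real-valued measurable
  functions, not by classes modulo equality almost everywhere. Measures, tail functions and the
  characteristics built from them take values in \<^typ>\<open>ennreal\<close>, where \<open>1 / 0 = \<infinity>\<close>,
  \<open>1 / \<infinity> = 0\<close> and the infimum of the empty set is \<open>\<infinity>\<close>.
\<close>

definition diffuse_measure :: "'a measure \<Rightarrow> bool" where
  "diffuse_measure M \<longleftrightarrow>
     (\<forall>B\<in>sets M. \<exists>D\<in>sets M. D \<subseteq> B \<and> emeasure M D = emeasure M B / 2)"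

definition tail_fun :: "'a measure \<Rightarrow> ('a \<Rightarrow> real) \<Rightarrow> real \<Rightarrow> ennreal" where
  "tail_fun M \<xi> t = emeasure M {\<omega> \<in> space M. t \<le> \<bar>\<xi> \<omega>\<bar>}"

definition equimeasurable :: "'a measure \<Rightarrow> ('a \<Rightarrow> real) \<Rightarrow> ('a \<Rightarrow> real) \<Rightarrow> bool" where
  "equimeasurable M \<xi> \<eta> \<longleftrightarrow> (\<forall>t>0. tail_fun M \<xi> t = tail_fun M \<eta> t)"


subsection \<open>Rearrangement invariant spaces\<close>

definition ri_norm :: "'a measure \<Rightarrow> ('a \<Rightarrow> real) set \<Rightarrow> (('a \<Rightarrow> real) \<Rightarrow> real) \<Rightarrow> bool" where
  "ri_norm M F nrm \<longleftrightarrow>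
     (\<forall>\<xi>\<in>F. 0 \<le> nrm \<xi>) \<and>
     (\<forall>\<xi>\<in>F. nrm \<xi> = 0 \<longleftrightarrow> (AE \<omega> in M. \<xi> \<omega> = 0)) \<and>
     (\<forall>\<xi>\<in>F. \<forall>a. nrm (\<lambda>\<omega>. a * \<xi> \<omega>) = \<bar>a\<bar> * nrm \<xi>) \<and>
     (\<forall>\<xi>\<in>F. \<forall>\<eta>\<in>F. nrm (\<lambda>\<omega>. \<xi> \<omega> + \<eta> \<omega>) \<le> nrm \<xi> + nrm \<eta>) \<and>
     (\<forall>\<xi>\<in>F. \<forall>\<eta>\<in>F. (AE \<omega> in M. \<bar>\<eta> \<omega>\<bar> \<le> \<bar>\<xi> \<omega>\<bar>) \<longrightarrow> nrm \<eta> \<le> nrm \<xi>) \<and>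
     (\<forall>\<xi>\<in>F. \<forall>\<eta>\<in>F. equimeasurable M \<xi> \<eta> \<longrightarrow> nrm \<eta> = nrm \<xi>)"

definition function_ideal :: "'a measure \<Rightarrow> ('a \<Rightarrow> real) set \<Rightarrow> bool" where
  "function_ideal M F \<longleftrightarrow>
     F \<subseteq> borel_measurable M \<and>
     (\<lambda>_. 0) \<in> F \<and>
     (\<forall>\<xi>\<in>F. \<forall>a. (\<lambda>\<omega>. a * \<xi> \<omega>) \<in> F) \<and>
     (\<forall>\<xi>\<in>F. \<forall>\<eta>\<in>F. (\<lambda>\<omega>. \<xi> \<omega> + \<eta> \<omega>) \<in> F) \<and>
     (\<forall>\<xi>\<in>F. \<forall>\<eta>\<in>borel_measurable M. (AE \<omega> in M. \<bar>\<eta> \<omega>\<bar> \<le> \<bar>\<xi> \<omega>\<bar>) \<longrightarrow> \<eta> \<in> F)"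

definition complete_norm :: "('a \<Rightarrow> real) set \<Rightarrow> (('a \<Rightarrow> real) \<Rightarrow> real) \<Rightarrow> bool" where
  "complete_norm F nrm \<longleftrightarrow>
     (\<forall>f. (\<forall>n::nat. f n \<in> F) \<and>
          (\<forall>e>0. \<exists>K. \<forall>m\<ge>K. \<forall>n\<ge>K. nrm (\<lambda>\<omega>. f m \<omega> - f n \<omega>) < e) \<longrightarrow>
          (\<exists>\<xi>\<in>F. (\<lambda>n. nrm (\<lambda>\<omega>. f n \<omega> - \<xi> \<omega>)) \<longlonglongrightarrow> 0))"

definition fatou_property ::
    "'a measure \<Rightarrow> ('a \<Rightarrow> real) set \<Rightarrow> (('a \<Rightarrow> real) \<Rightarrow> real) \<Rightarrow> bool" where
  "fatou_property M F nrm \<longleftrightarrow>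
     (\<forall>f. \<forall>\<xi>\<in>borel_measurable M.
        (\<forall>n::nat. f n \<in> F) \<and>
        (AE \<omega> in M. 0 \<le> f 0 \<omega> \<and> incseq (\<lambda>n. f n \<omega>) \<and> (\<lambda>n. f n \<omega>) \<longlonglongrightarrow> \<xi> \<omega>) \<and>
        bdd_above (range (\<lambda>n. nrm (f n))) \<longrightarrow>
        \<xi> \<in> F \<and> (\<lambda>n. nrm (f n)) \<longlonglongrightarrow> nrm \<xi>)"

text \<open>
  Rearrangement invariant Banach function spaces in the sense of Bennett and Sharpley. Their norms
  are functionals with values in \<open>[0, \<infinity>]\<close> on all measurable functions; here the space is the set
  on which the norm is finite, and closedness of this set under the order and under
  equimeasurability is therefore stated explicitly.
\<close>

definition ri_space :: "'a measure \<Rightarrow> ('a \<Rightarrow> real) set \<Rightarrow> (('a \<Rightarrow> real) \<Rightarrow> real) \<Rightarrow> bool" where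
  "ri_space M F nrm \<longleftrightarrow>
     function_ideal M F \<and>
     (\<forall>\<xi>\<in>F. \<forall>\<eta>\<in>borel_measurable M. equimeasurable M \<xi> \<eta> \<longrightarrow> \<eta> \<in> F) \<and>
     ri_norm M F nrm \<and>
     complete_norm F nrm \<and>
     fatou_property M F nrm \<and>
     (\<forall>E\<in>sets M. emeasure M E < \<infinity> \<longrightarrow> indicat_real E \<in> F) \<and>
     (\<forall>E\<in>sets M. emeasure M E < \<infinity> \<longrightarrow>
        (\<exists>C\<ge>0. \<forall>\<xi>\<in>F. (\<integral>\<^sup>+\<omega>\<in>E. ennreal \<bar>\<xi> \<omega>\<bar> \<partial>M) \<le> ennreal (C * nrm \<xi>)))"

definition equivalent_norms ::
    "('a \<Rightarrow> real) set \<Rightarrow> (('a \<Rightarrow> real) \<Rightarrow> real) \<Rightarrow> (('a \<Rightarrow> real) \<Rightarrow> real) \<Rightarrow> bool" where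
  "equivalent_norms F nrm nrm' \<longleftrightarrow>
     (\<exists>c>0. \<exists>C>0. \<forall>\<xi>\<in>F. c * nrm \<xi> \<le> nrm' \<xi> \<and> nrm' \<xi> \<le> C * nrm \<xi>)"


subsection \<open>Regularity\<close>

definition tchebychev_char ::
    "'a measure \<Rightarrow> ('a \<Rightarrow> real) set \<Rightarrow> (('a \<Rightarrow> real) \<Rightarrow> real) \<Rightarrow> real \<Rightarrow> ennreal" where
  "tchebychev_char M F nrm t = (SUP \<xi>\<in>{\<xi>\<in>F. nrm \<xi> = 1}. tail_fun M \<xi> t)"

definition fundamental_fun :: "'a measure \<Rightarrow> (('a \<Rightarrow> real) \<Rightarrow> real) \<Rightarrow> real \<Rightarrow> ennreal" where
  "fundamental_fun M nrm \<delta> =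
     (SUP D\<in>{D\<in>sets M. emeasure M D \<le> ennreal \<delta>}. ennreal (nrm (indicat_real D)))"

definition g_fun :: "'a measure \<Rightarrow> (('a \<Rightarrow> real) \<Rightarrow> real) \<Rightarrow> real \<Rightarrow> ennreal" where
  "g_fun M nrm s = 1 / fundamental_fun M nrm (1 / s)"

text \<open>
  The left inverse. As \<^term>\<open>g_fun M nrm\<close> is nondecreasing, it agrees with the ordinary inverse on
  the range of \<^term>\<open>g_fun M nrm\<close> whenever that function is strictly monotone.
\<close>

definition g_inv :: "'a measure \<Rightarrow> (('a \<Rightarrow> real) \<Rightarrow> real) \<Rightarrow> real \<Rightarrow> ennreal" where
  "g_inv M nrm t = (INF s\<in>{s. 0 < s \<and> ennreal t \<le> g_fun M nrm s}. ennreal s)"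

definition regular_ri ::
    "'a measure \<Rightarrow> ('a \<Rightarrow> real) set \<Rightarrow> (('a \<Rightarrow> real) \<Rightarrow> real) \<Rightarrow> bool" where
  "regular_ri M F nrm \<longleftrightarrow>
     (\<exists>t0>0. \<forall>t>t0. g_inv M nrm t = 1 / tchebychev_char M F nrm t)"

definition weakly_regular_ri ::
    "'a measure \<Rightarrow> ('a \<Rightarrow> real) set \<Rightarrow> (('a \<Rightarrow> real) \<Rightarrow> real) \<Rightarrow> bool" where
  "weakly_regular_ri M F nrm \<longleftrightarrow>
     (\<exists>t0>0. \<exists>c>0. \<exists>C>0. \<forall>t>t0.
        ennreal c * (1 / tchebychev_char M F nrm t) \<le> g_inv M nrm t \<and>
        g_inv M nrm t \<le> ennreal C * (1 / tchebychev_char M F nrm t))"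


subsection \<open>Orlicz spaces\<close>

text \<open>Only the values on \<open>[0, \<infinity>)\<close> matter, so evenness is not demanded.\<close>

definition young_function :: "(real \<Rightarrow> real) \<Rightarrow> bool" where
  "young_function N \<longleftrightarrow>
     N 0 = 0 \<and> (\<forall>u\<ge>0. 0 \<le> N u) \<and> convex_on {0..} N \<and> filterlim N at_top at_top"

definition luxemburg_set :: "'a measure \<Rightarrow> (real \<Rightarrow> real) \<Rightarrow> ('a \<Rightarrow> real) \<Rightarrow> real set" where
  "luxemburg_set M N \<xi> = {k. 0 < k \<and> (\<integral>\<^sup>+\<omega>. ennreal (N (\<bar>\<xi> \<omega>\<bar> / k)) \<partial>M) \<le> 1}"

definition luxemburg_norm :: "'a measure \<Rightarrow> (real \<Rightarrow> real) \<Rightarrow> ('a \<Rightarrow> real) \<Rightarrow> real" where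
  "luxemburg_norm M N \<xi> = Inf (luxemburg_set M N \<xi>)"

text \<open>Nonemptiness of the set says that the Luxemburg norm, read in \<open>[0, \<infinity>]\<close>, is finite.\<close>

definition orlicz_space :: "'a measure \<Rightarrow> (real \<Rightarrow> real) \<Rightarrow> ('a \<Rightarrow> real) set" where
  "orlicz_space M N = {\<xi>\<in>borel_measurable M. luxemburg_set M N \<xi> \<noteq> {}}"

end

theory Submission
  imports Defs
begin

text \<open>
  Let \<open>\<phi>\<close> be the fundamental function of a rearrangement invariant norm. Over a diffuse measure
  \<open>\<phi> (a + b) \<le> \<phi> a + \<phi> b\<close>, so \<open>\<phi>\<close> is continuous as soon as it vanishes at \<open>0+\<close>. If \<open>\<xi>\<close> has norm
  \<open>1\<close>, then \<open>t I {\<bar>\<xi>\<bar> \<ge> t} \<le> \<bar>\<xi>\<bar>\<close> gives \<open>\<phi> (T\<^sub>\<xi> t) \<le> 1 / t\<close>; conversely, if \<open>\<phi> (\<mu> D) = 1 / t\<close>, then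
  \<open>t I D\<close> has norm \<open>1\<close> and tail \<open>\<mu> D\<close> at \<open>t\<close>. Hence \<open>1 / T t\<close> is exactly the left inverse of \<open>g\<close>, for
  large \<open>t\<close>. Vanishing at \<open>0+\<close> passes to every equivalent norm, so all equivalent
  rearrangement invariant norms on an Orlicz space are regular, with no \<open>\<Delta>\<^sub>2\<close> condition on \<open>N\<close>.
\<close>

subsection \<open>Diffuse measures\<close>

text \<open>Inversion is an order reversing involution of [0, infinity]. The extreme values 0 and
  infinity are settled separately; the others reduce to positive reals.\<close>

lemma ennreal_le_one_divide_swap:
  fixes x y :: ennreal
  assumes "x \<le> 1 / y"
  shows "y \<le> 1 / x"
proof (cases "x = 0 \<or> y = 0 \<or> x = top \<or> y = top")
  case True
  then show ?thesis using assms by (auto simp: top_unique ennreal_divide_eq_top_iff)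
next
  case False
  then obtain a b where ab: "x = ennreal a" "y = ennreal b" "0 < a" "0 < b"
    by (cases x; cases y) (auto simp: less_le)
  have "ennreal a \<le> ennreal (1 / b)"
    using assms ab by (simp flip: ennreal_1 add: divide_ennreal)
  then have "b \<le> 1 / a"
    using ab by (simp add: field_simps)
  then show ?thesis
    using ab by (simp flip: ennreal_1 add: divide_ennreal ennreal_leI)
qed

lemma ennreal_le_one_divide_iff:
  fixes x y :: ennreal
  shows "x \<le> 1 / y \<longleftrightarrow> y \<le> 1 / x"
  using ennreal_le_one_divide_swap by blast

lemma one_divide_one_divide_ennreal: "1 / (1 / x) = (x :: ennreal)"
  by (rule antisym) (simp_all add: ennreal_le_one_divide_iff[of x] flip: ennreal_le_one_divide_iff)

section \<open>Subsets of prescribed measure\<close>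

text \<open>Bisection: d is bracketed between the measures of nested sets, and diffuseness halves
  the difference set, so the gap tends to 0. Continuity from below along the growing inner sets
  gives measure exactly d.\<close>

lemma diffuse_measure_finite_subset:
  assumes "diffuse_measure M" and "B \<in> fmeasurable M" and "0 \<le> d" and "d \<le> measure M B"
  obtains D where "D \<in> sets M" "D \<subseteq> B" "emeasure M D = ennreal d"
proof -
  \<comment> \<open>\<open>P n\<close> is the bracket after n halvings, starting from the empty set
    and \<open>B\<close>. \<open>Q\<close> records that the inner sets grow, so that the measure of
    their union is a limit from below.\<close>
  define P where "P = (\<lambda>n (L, U). L \<in> fmeasurable M \<and> U \<in> fmeasurable M \<and> L \<subseteq> U \<and> U \<subseteq> B \<and>
      measure M L \<le> d \<and> d \<le> measure M U \<and> measure M U - measure M L = measure M B / 2 ^ n)"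
  define Q where "Q = (\<lambda>(n::nat) (L, U :: 'a set) (L', U' :: 'a set). L \<subseteq> (L' :: 'a set))"
  have "\<exists>f. \<forall>n. P n (f n) \<and> Q n (f n) (f (Suc n))"
  proof (rule dependent_nat_choice)
    show "\<exists>x. P 0 x"
      by (rule exI[of _ "({}, B)"]) (use assms in \<open>auto simp: P_def\<close>)
  next
    fix x n assume "P n x"
    then obtain L U where x: "x = (L, U)" and LU: "L \<in> fmeasurable M" "U \<in> fmeasurable M" "L \<subseteq> U"
        "U \<subseteq> B" "measure M L \<le> d" "d \<le> measure M U"
        "measure M U - measure M L = measure M B / 2 ^ n"
      by (cases x) (auto simp: P_def)
    have UL: "U - L \<in> fmeasurable M" using LU by auto
    then obtain D where D: "D \<in> sets M" "D \<subseteq> U - L" "emeasure M D = emeasure M (U - L) / 2"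
      using assms(1) unfolding diffuse_measure_def by (meson fmeasurableD)
    have Df: "D \<in> fmeasurable M"
      by (rule fmeasurableI2[OF UL D(2,1)])
    have "measure M (U - L) = measure M U - measure M L"
      using LU by (intro measurable_measure_Diff) auto
    moreover have "measure M D = measure M (U - L) / 2"
      using D(3) by (simp add: emeasure_eq_measure2 UL Df ennreal_divide_numeral)
    ultimately have mD: "measure M D = measure M B / 2 ^ n / 2"
      using LU by simp
    have LD: "L \<union> D \<in> fmeasurable M" using LU Df by auto
    have mLD: "measure M (L \<union> D) = measure M L + measure M D"
      using LU(1) Df D(2) by (intro measure_Union) (auto simp: fmeasurable_def)
    have half: "measure M U - measure M (L \<union> D) = measure M B / 2 ^ Suc n"
        "measure M (L \<union> D) - measure M L = measure M B / 2 ^ Suc n"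
      using mLD mD LU(7) by (simp_all add: field_simps)
    \<comment> \<open>In measure, \<open>L \<union> D\<close> lies halfway between \<open>L\<close>
      and \<open>U\<close>; it becomes the new inner or the new outer set according to the side on
      which d lies.\<close>
    show "\<exists>y. P (Suc n) y \<and> Q n x y"
    proof (cases "measure M (L \<union> D) \<le> d")
      case True
      have "P (Suc n) (L \<union> D, U) \<and> Q n x (L \<union> D, U)"
        using True LU LD D(2) half x by (auto simp: P_def Q_def)
      then show ?thesis ..
    next
      case False
      have "P (Suc n) (L, L \<union> D) \<and> Q n x (L, L \<union> D)"
        using False LU LD D(2) half x by (auto simp: P_def Q_def)
      then show ?thesis ..
    qed
  qed
  then obtain f where f: "\<And>n. P n (f n)" "\<And>n. Q n (f n) (f (Suc n))" by blast
  define L where "L = (\<lambda>n. fst (f n))"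
  have L: "L n \<in> fmeasurable M" "L n \<subseteq> B" "measure M (L n) \<le> d"
      "d - measure M B / 2 ^ n \<le> measure M (L n)" for n
    using f(1)[of n] by (auto simp: P_def L_def split_beta)
  have inc: "incseq L"
    using f(2) by (intro incseq_SucI) (auto simp: Q_def L_def split_beta)
  have "(\<lambda>n. emeasure M (L n)) \<longlonglongrightarrow> emeasure M (\<Union>n. L n)"
    using L inc by (intro Lim_emeasure_incseq) auto
  moreover have "(\<lambda>n. measure M (L n)) \<longlonglongrightarrow> d"
  proof (rule tendsto_sandwich[where f = "\<lambda>n. d - measure M B / 2 ^ n" and h = "\<lambda>_. d"])
    have "(\<lambda>n. d - measure M B * (1 / 2) ^ n) \<longlonglongrightarrow> d - measure M B * 0"
      by (intro tendsto_intros LIMSEQ_power_zero) auto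
    then show "(\<lambda>n. d - measure M B / 2 ^ n) \<longlonglongrightarrow> d"
      by (simp add: power_one_over field_simps)
  qed (use L in auto)
  then have "(\<lambda>n. emeasure M (L n)) \<longlonglongrightarrow> ennreal d"
    using L(1) by (simp add: emeasure_eq_measure2 tendsto_ennrealI)
  ultimately have "emeasure M (\<Union>n. L n) = ennreal d"
    using LIMSEQ_unique by blast
  then show ?thesis
    using that[of "\<Union>n. L n"] L by auto
qed

text \<open>By sigma-finiteness a set of infinite measure contains one of finite measure above d, to
  which the bisection applies.\<close>

lemma (in sigma_finite_measure) diffuse_measure_subset:
  assumes "diffuse_measure M" and "B \<in> sets M" and "0 \<le> d" and "ennreal d \<le> emeasure M B"
  obtains D where "D \<in> sets M" "D \<subseteq> B" "emeasure M D = ennreal d"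
proof -
  obtain Z where Z: "Z \<in> sets M" "Z \<subseteq> B" "emeasure M Z < \<infinity>" "ennreal d \<le> emeasure M Z"
  proof (cases "emeasure M B = \<infinity>")
    case True
    then show ?thesis
      using approx_PInf_emeasure_with_finite[OF assms(2), of d] that
      by (metis less_imp_le)
  next
    case False
    then show ?thesis using that[of B] assms by (auto simp: less_top)
  qed
  have "d \<le> measure M Z"
    using Z assms by (simp add: emeasure_eq_ennreal_measure less_top)
  with diffuse_measure_finite_subset[OF assms(1) _ assms(3), of Z] Z that show ?thesis
    by (metis fmeasurableI order_trans)
qed

subsection \<open>Rearrangement invariant norms\<close>

lemma function_ideal_add:
  "function_ideal M F \<Longrightarrow> \<xi> \<in> F \<Longrightarrow> \<eta> \<in> F \<Longrightarrow> (\<lambda>\<omega>. \<xi> \<omega> + \<eta> \<omega>) \<in> F"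
  by (simp add: function_ideal_def)

lemma function_ideal_scale:
  "function_ideal M F \<Longrightarrow> \<xi> \<in> F \<Longrightarrow> (\<lambda>\<omega>. a * \<xi> \<omega>) \<in> F"
  by (simp add: function_ideal_def)

lemma function_ideal_mono:
  "function_ideal M F \<Longrightarrow> \<xi> \<in> F \<Longrightarrow> \<eta> \<in> borel_measurable M \<Longrightarrow>
    (AE \<omega> in M. \<bar>\<eta> \<omega>\<bar> \<le> \<bar>\<xi> \<omega>\<bar>) \<Longrightarrow> \<eta> \<in> F"
  by (simp add: function_ideal_def)

lemma function_ideal_zero: "function_ideal M F \<Longrightarrow> (\<lambda>_. 0) \<in> F"
  by (simp add: function_ideal_def)

lemma function_ideal_measurable: "function_ideal M F \<Longrightarrow> \<xi> \<in> F \<Longrightarrow> \<xi> \<in> borel_measurable M"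
  by (auto simp: function_ideal_def)

lemma function_ideal_diff:
  assumes "function_ideal M F" "\<xi> \<in> F" "\<eta> \<in> F"
  shows "(\<lambda>\<omega>. \<xi> \<omega> - \<eta> \<omega>) \<in> F"
  using function_ideal_add[OF assms(1,2) function_ideal_scale[OF assms(1,3), of "-1"]] by simp

lemma ri_norm_scale:
  "ri_norm M F nrm \<Longrightarrow> \<xi> \<in> F \<Longrightarrow> nrm (\<lambda>\<omega>. a * \<xi> \<omega>) = \<bar>a\<bar> * nrm \<xi>"
  by (simp add: ri_norm_def)

lemma ri_norm_mono:
  "ri_norm M F nrm \<Longrightarrow> \<xi> \<in> F \<Longrightarrow> \<eta> \<in> F \<Longrightarrow> (AE \<omega> in M. \<bar>\<eta> \<omega>\<bar> \<le> \<bar>\<xi> \<omega>\<bar>) \<Longrightarrow> nrm \<eta> \<le> nrm \<xi>"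
  by (simp add: ri_norm_def)

lemma ri_norm_triangle:
  "ri_norm M F nrm \<Longrightarrow> \<xi> \<in> F \<Longrightarrow> \<eta> \<in> F \<Longrightarrow> nrm (\<lambda>\<omega>. \<xi> \<omega> + \<eta> \<omega>) \<le> nrm \<xi> + nrm \<eta>"
  by (simp add: ri_norm_def)

lemma ri_norm_nonneg: "ri_norm M F nrm \<Longrightarrow> \<xi> \<in> F \<Longrightarrow> 0 \<le> nrm \<xi>"
  by (simp add: ri_norm_def)

text \<open>The tail of an indicator at t is the measure of the set for t up to 1, and 0
  beyond.\<close>

lemma equimeasurable_indicator:
  assumes "D \<in> sets M" "E \<in> sets M" "emeasure M D = emeasure M E"
  shows "equimeasurable M (indicat_real D) (indicat_real E)"
proof -
  have *: "{\<omega> \<in> space M. t \<le> \<bar>indicat_real A \<omega>\<bar>} = (if t \<le> 1 then A else {})"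
    if "0 < t" "A \<in> sets M" for t A
    using that sets.sets_into_space[OF that(2)] by (auto simp: indicator_def split: if_splits)
  show ?thesis
    unfolding equimeasurable_def tail_fun_def
    using assms(3) *[OF _ assms(1)] *[OF _ assms(2)] by metis
qed

lemma ri_norm_indicator_mono:
  assumes "ri_norm M F nrm" "indicat_real D \<in> F" "indicat_real E \<in> F" "D \<subseteq> E"
  shows "nrm (indicat_real D) \<le> nrm (indicat_real E)"
  using assms by (intro ri_norm_mono[OF assms(1)]) (auto simp: indicator_def)

lemma ri_norm_indicator_cong:
  assumes "ri_norm M F nrm" "indicat_real D \<in> F" "indicat_real E \<in> F"
    and "D \<in> sets M" "E \<in> sets M" "emeasure M D = emeasure M E"
  shows "nrm (indicat_real D) = nrm (indicat_real E)"
  using assms(1-3) equimeasurable_indicator[OF assms(4-6)] unfolding ri_norm_def by metis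

section \<open>Continuity of the fundamental function and regularity\<close>

text \<open>Rearrangement invariance makes the norm of an indicator a function of the measure alone.
  It is nondecreasing and subadditive, and smallness near 0 turns subadditivity into continuity, so
  the intermediate value theorem applies between the measures of \<open>A\<close> and
  \<open>B\<close>.\<close>

lemma (in sigma_finite_measure) ri_norm_indicator_IVT:
  assumes diffuse: "diffuse_measure M" and ri: "ri_norm M F nrm"
    and ind: "\<And>E. E \<in> sets M \<Longrightarrow> emeasure M E < \<infinity> \<Longrightarrow> indicat_real E \<in> F"
    and small: "\<And>e. e > 0 \<Longrightarrow>
      \<exists>d>0. \<forall>E\<in>sets M. emeasure M E \<le> ennreal d \<longrightarrow> nrm (indicat_real E) \<le> e"
    and A: "A \<in> sets M" "emeasure M A < \<infinity>" "nrm (indicat_real A) \<le> y"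
    and B: "B \<in> sets M" "emeasure M B < \<infinity>" "y \<le> nrm (indicat_real B)"
    and le: "emeasure M A \<le> emeasure M B"
  obtains D where "D \<in> sets M" "emeasure M A \<le> emeasure M D" "emeasure M D < \<infinity>"
    "nrm (indicat_real D) = y"
proof -
  define m where "m = measure M B"
  \<comment> \<open>By rearrangement invariance the chosen representative does not influence the
    value. Only arguments in [0, m] are considered, where diffuseness guarantees that a
    representative exists.\<close>
  define f where "f x = nrm (indicat_real (SOME D. D \<in> sets M \<and> emeasure M D = ennreal x))" for x
  have f: "f (measure M D) = nrm (indicat_real D)" if "D \<in> sets M" "emeasure M D < \<infinity>" for D
  proof -
    let ?D = "SOME D'. D' \<in> sets M \<and> emeasure M D' = ennreal (measure M D)"
    have "?D \<in> sets M \<and> emeasure M ?D = ennreal (measure M D)"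
      by (rule someI[of _ D]) (use that in \<open>simp add: emeasure_eq_ennreal_measure less_top\<close>)
    then show ?thesis
      unfolding f_def using that
      by (intro ri_norm_indicator_cong[OF ri] ind) (auto simp: emeasure_eq_ennreal_measure less_top)
  qed
  have Bm: "emeasure M B = ennreal m"
    using B by (simp add: m_def emeasure_eq_ennreal_measure less_top)
  have ex: "\<exists>D\<in>sets M. D \<subseteq> C \<and> emeasure M D = ennreal x"
    if "0 \<le> x" "ennreal x \<le> emeasure M C" "C \<in> sets M" for x C
    using diffuse_measure_subset[OF diffuse that(3,1,2)] by metis
  \<comment> \<open>A set of measure z is cut into pieces of measure x and z - x: the lattice
    property gives monotonicity, the triangle inequality subadditivity.\<close>
  have sub: "f x \<le> f z \<and> f z \<le> f x + f (z - x)" if xz: "0 \<le> x" "x \<le> z" "z \<le> m" for x z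
  proof -
    obtain D where D: "D \<in> sets M" "emeasure M D = ennreal z"
      using ex[of z B] Bm ennreal_leI[of z m] xz B(1) by auto
    obtain E where E: "E \<in> sets M" "E \<subseteq> D" "emeasure M E = ennreal x"
      using ex[of x D] D ennreal_leI[of x z] xz by auto
    have DE: "emeasure M (D - E) = ennreal (z - x)"
      using D E that by (simp add: emeasure_Diff ennreal_minus)
    have F: "indicat_real D \<in> F" "indicat_real E \<in> F" "indicat_real (D - E) \<in> F"
      using D E DE by (auto intro!: ind)
    have eq: "f z = nrm (indicat_real D)" "f x = nrm (indicat_real E)"
        "f (z - x) = nrm (indicat_real (D - E))"
      using f[of D] f[of E] f[of "D - E"] D E DE that by (auto simp: measure_def)
    have "indicat_real D = (\<lambda>\<omega>. indicat_real E \<omega> + indicat_real (D - E) \<omega>)"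
      using E(2) by (auto simp: fun_eq_iff indicator_def)
    then have "f z \<le> f x + f (z - x)"
      using ri_norm_triangle[OF ri F(2,3)] eq by simp
    moreover have "f x \<le> f z"
      using ri_norm_indicator_mono[OF ri F(2,1) E(2)] eq by simp
    ultimately show ?thesis by simp
  qed
  have "continuous_on {measure M A..m} f"
    unfolding continuous_on_iff
  proof (intro ballI allI impI)
    fix x e :: real assume x: "x \<in> {measure M A..m}" and e: "0 < e"
    \<comment> \<open>The increment of \<open>f\<close> over a gap w is at most \<open>f w\<close>;
      the bound e / 2 leaves room for the strict inequality in the definition of continuity.\<close>
    obtain d where d: "d > 0" "\<And>E. E \<in> sets M \<Longrightarrow> emeasure M E \<le> ennreal d \<Longrightarrow>
        nrm (indicat_real E) \<le> e / 2"
      using small[of "e / 2"] e by auto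
    have fd: "f w \<le> e / 2" if w: "0 \<le> w" "w < d" "w \<le> m" for w
    proof -
      obtain D where D: "D \<in> sets M" "emeasure M D = ennreal w"
        using ex[of w B] Bm ennreal_leI[of w m] w B(1) by auto
      then show ?thesis
        using f[of D] d(2)[of D] that by (auto simp: measure_def ennreal_leI)
    qed
    show "\<exists>d>0. \<forall>x'\<in>{measure M A..m}. dist x' x < d \<longrightarrow> dist (f x') (f x) < e"
    proof (intro exI[of _ d] conjI ballI impI)
      fix x' assume x': "x' \<in> {measure M A..m}" "dist x' x < d"
      have x0: "0 \<le> x" "0 \<le> x'"
        using x x'(1) measure_nonneg[of M A] unfolding atLeastAtMost_iff by linarith+
      show "dist (f x') (f x) < e"
      proof (cases "x \<le> x'")
        case True
        then show ?thesis
          using sub[of x x'] fd[of "x' - x"] x x' x0 e by (auto simp: dist_real_def)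
      next
        case False
        then show ?thesis
          using sub[of x' x] fd[of "x - x'"] x x' x0 e by (auto simp: dist_real_def)
      qed
    qed (use d in auto)
  qed
  moreover have "measure M A \<le> m"
    using le A Bm by (metis emeasure_eq_ennreal_measure ennreal_le_iff infinity_ennreal_def less_top m_def measure_nonneg)
  moreover have "f (measure M A) \<le> y" "y \<le> f m"
    using f A B by (auto simp: m_def)
  ultimately obtain x where x: "measure M A \<le> x" "x \<le> m" "f x = y"
    using IVT'[of f "measure M A" y m] by auto
  have x0: "0 \<le> x" using x(1) measure_nonneg[of M A] by linarith
  obtain D where D: "D \<in> sets M" "emeasure M D = ennreal x"
    using ex[of x B] Bm ennreal_leI[of x m] x(2) x0 B(1) by auto
  show ?thesis
  proof (rule that[of D])
    show "nrm (indicat_real D) = y"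
      using f[of D] D x x0 by (simp add: measure_def)
    show "emeasure M A \<le> emeasure M D"
      using D x A by (simp add: emeasure_eq_ennreal_measure less_top ennreal_leI)
  qed (use D in auto)
qed

text \<open>A competitor \<open>D\<close> of measure at most d can be moved inside the set where
  |\<xi>| \<ge> t without changing its norm. There its indicator is dominated by |\<xi>| / t, a
  function of norm 1 / t.\<close>

lemma (in sigma_finite_measure) fundamental_fun_le_of_le_tail_fun:
  assumes diffuse: "diffuse_measure M" and ri: "ri_norm M F nrm" and ideal: "function_ideal M F"
    and ind: "\<And>E. E \<in> sets M \<Longrightarrow> emeasure M E < \<infinity> \<Longrightarrow> indicat_real E \<in> F"
    and \<xi>: "\<xi> \<in> F" "nrm \<xi> = 1" and t: "0 < t" and d: "0 < d" "ennreal d \<le> tail_fun M \<xi> t"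
  shows "fundamental_fun M nrm d \<le> 1 / ennreal t"
proof -
  have [measurable]: "\<xi> \<in> borel_measurable M"
    using \<xi> ideal by (auto simp: function_ideal_def)
  have "nrm (indicat_real D) \<le> 1 / t" if D: "D \<in> sets M" "emeasure M D \<le> ennreal d" for D
  proof -
    define S where "S = {\<omega> \<in> space M. t \<le> \<bar>\<xi> \<omega>\<bar>}"
    have S: "S \<in> sets M" "emeasure M D \<le> emeasure M S"
      using d D by (auto simp: S_def tail_fun_def)
    have Dfin: "emeasure M D < \<infinity>" using D by (auto simp: less_top intro: le_less_trans)
    have "ennreal (measure M D) \<le> emeasure M S"
      using S Dfin by (simp add: emeasure_eq_ennreal_measure less_top)
    then obtain E where E: "E \<in> sets M" "E \<subseteq> S" "emeasure M E = ennreal (measure M D)"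
      using diffuse_measure_subset[OF diffuse S(1) measure_nonneg] by metis
    have F: "indicat_real D \<in> F" "indicat_real E \<in> F" using D Dfin E by (auto intro!: ind)
    have "(\<lambda>\<omega>. (1 / t) * \<xi> \<omega>) \<in> F" using function_ideal_scale[OF ideal \<xi>(1)] .
    then have "nrm (indicat_real E) \<le> nrm (\<lambda>\<omega>. (1 / t) * \<xi> \<omega>)"
      using E(2) t by (intro ri_norm_mono[OF ri _ F(2)])
        (auto simp: indicator_def S_def abs_mult field_simps)
    also have "\<dots> = 1 / t" using ri_norm_scale[OF ri \<xi>(1), of "1 / t"] \<xi> t by simp
    also have "nrm (indicat_real E) = nrm (indicat_real D)"
      using F D E Dfin
      by (intro ri_norm_indicator_cong[OF ri]) (auto simp: emeasure_eq_ennreal_measure less_top)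
    finally show ?thesis .
  qed
  then have "fundamental_fun M nrm d \<le> ennreal (1 / t)"
    unfolding fundamental_fun_def by (intro SUP_least) (auto intro!: ennreal_leI)
  then show ?thesis using t by (simp flip: ennreal_1 add: divide_ennreal)
qed

text \<open>One inequality is the preceding tail estimate, applied to every function of norm 1. The
  other needs an extremal function, namely t times an indicator of norm exactly 1 / t, which the
  intermediate value argument supplies.\<close>

lemma (in sigma_finite_measure) ri_norm_regular:
  assumes diffuse: "diffuse_measure M" and nontriv: "emeasure M (space M) \<noteq> 0"
    and ri: "ri_norm M F nrm" and ideal: "function_ideal M F"
    and ind: "\<And>E. E \<in> sets M \<Longrightarrow> emeasure M E < \<infinity> \<Longrightarrow> indicat_real E \<in> F"
    and small: "\<And>e. e > 0 \<Longrightarrow>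
      \<exists>d>0. \<forall>E\<in>sets M. emeasure M E \<le> ennreal d \<longrightarrow> nrm (indicat_real E) \<le> e"
  shows "regular_ri M F nrm"
proof -
  obtain r where r: "0 < r" "ennreal r \<le> emeasure M (space M)"
  proof (cases "emeasure M (space M)")
    case (real r)
    then show ?thesis using nontriv that[of r] by (auto simp: less_le)
  next
    case top
    then show ?thesis using that[of 1] by simp
  qed
  obtain B where B: "B \<in> sets M" "emeasure M B = ennreal r"
    using diffuse_measure_subset[OF diffuse sets.top _ r(2)] r(1) by auto
  have BF: "indicat_real B \<in> F" using B by (auto intro: ind)
  \<comment> \<open>Positive measure makes the norm of the indicator of \<open>B\<close> positive.
    Its reciprocal is the threshold for t, so that 1 / t stays below the norm available at
    \<open>B\<close>.\<close>
  have "\<not> (AE \<omega> in M. indicat_real B \<omega> = 0)"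
    using B r AE_iff_measurable[of B M "\<lambda>\<omega>. indicat_real B \<omega> = 0"] sets.sets_into_space[OF B(1)]
    by (auto simp: indicator_def)
  then have nB: "0 < nrm (indicat_real B)"
    using ri BF unfolding ri_norm_def by (metis less_le)
  show ?thesis
    unfolding regular_ri_def
  proof (intro exI[of _ "1 / nrm (indicat_real B)"] conjI allI impI)
    fix t assume "1 / nrm (indicat_real B) < t"
    then have t: "0 < t" "1 / t < nrm (indicat_real B)"
      using nB less_trans[of 0 "1 / nrm (indicat_real B)" t] by (auto simp: field_simps)
    \<comment> \<open>Taking reciprocals turns g(s) \<ge> t into an upper bound on the fundamental
      function at 1 / s, including the values 0 and infinity.\<close>
    have set_eq: "{s. 0 < s \<and> ennreal t \<le> g_fun M nrm s} =
        {s. 0 < s \<and> fundamental_fun M nrm (1 / s) \<le> 1 / ennreal t}"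
      unfolding g_fun_def by (subst ennreal_le_one_divide_iff) simp
    show "g_inv M nrm t = 1 / tchebychev_char M F nrm t"
    proof (rule antisym)
      have "tchebychev_char M F nrm t \<le> 1 / g_inv M nrm t"
        unfolding tchebychev_char_def
      proof (rule SUP_least)
        fix \<xi> assume "\<xi> \<in> {\<xi> \<in> F. nrm \<xi> = 1}"
        then have \<xi>: "\<xi> \<in> F" "nrm \<xi> = 1" by auto
        \<comment> \<open>By the tail estimate, s = 1 / d is admissible in the infimum that defines
          \<open>g_inv\<close>.\<close>
        have *: "ennreal d \<le> 1 / g_inv M nrm t" if d: "0 < d" "ennreal d \<le> tail_fun M \<xi> t" for d
        proof -
          have "fundamental_fun M nrm d \<le> 1 / ennreal t"
            using fundamental_fun_le_of_le_tail_fun[OF diffuse ri ideal ind \<xi> t(1) d] .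
          then have "g_inv M nrm t \<le> ennreal (1 / d)"
            unfolding g_inv_def set_eq using d by (intro INF_lower) auto
          also have "\<dots> = 1 / ennreal d"
            using d by (simp flip: ennreal_1 add: divide_ennreal)
          finally show ?thesis by (rule ennreal_le_one_divide_swap)
        qed
        \<comment> \<open>The tail may be infinite, so it is approached from below by positive reals
          d.\<close>
        show "tail_fun M \<xi> t \<le> 1 / g_inv M nrm t"
        proof (rule dense_le)
          fix y assume y: "y < tail_fun M \<xi> t"
          show "y \<le> 1 / g_inv M nrm t"
          proof (cases "y = 0")
            case False
            obtain d where "y = ennreal d" "0 \<le> d"
              using y by (cases y) auto
            with * False y show ?thesis by (auto simp: less_le)
          qed auto
        qed
      qed
      then show "g_inv M nrm t \<le> 1 / tchebychev_char M F nrm t"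
        by (rule ennreal_le_one_divide_swap)
    next
      show "1 / tchebychev_char M F nrm t \<le> g_inv M nrm t"
        unfolding g_inv_def set_eq
      proof (rule INF_greatest)
        fix s assume "s \<in> {s. 0 < s \<and> fundamental_fun M nrm (1 / s) \<le> 1 / ennreal t}"
        then have s: "0 < s" "fundamental_fun M nrm (1 / s) \<le> ennreal (1 / t)"
          using t by (auto simp flip: ennreal_1 simp: divide_ennreal)
        have bound: "nrm (indicat_real D) \<le> 1 / t"
          if "D \<in> sets M" "emeasure M D \<le> ennreal (1 / s)" for D
        proof -
          have "ennreal (nrm (indicat_real D)) \<le> fundamental_fun M nrm (1 / s)"
            unfolding fundamental_fun_def using that by (intro SUP_upper) auto
          then show ?thesis using s t by (auto dest: order_trans)
        qed
        \<comment> \<open>Otherwise \<open>B\<close> would be a competitor of measure at most 1 / s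
          and its norm would be at most 1 / t, against the choice of the threshold.\<close>
        have "ennreal (1 / s) \<le> emeasure M B"
          using bound[OF B(1)] t by (meson not_le linear)
        then obtain A where A: "A \<in> sets M" "emeasure M A = ennreal (1 / s)"
          using diffuse_measure_subset[OF diffuse B(1)] s by (metis divide_nonneg_pos zero_le_one)
        \<comment> \<open>\<open>A\<close> has norm at most 1 / t and \<open>B\<close> a larger one.
          Interpolating upward from \<open>A\<close> gives norm exactly 1 / t at measure at least 1
          / s; scaling by t then gives norm 1 and tail at least 1 / s at t.\<close>
        obtain D where D: "D \<in> sets M" "emeasure M A \<le> emeasure M D" "emeasure M D < \<infinity>"
            "nrm (indicat_real D) = 1 / t"
        proof (rule ri_norm_indicator_IVT[OF diffuse ri ind small, of A "1 / t" B])
          show "emeasure M A \<le> emeasure M B" using A \<open>ennreal (1 / s) \<le> emeasure M B\<close> by simp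
        qed (use A B t bound in auto)
        define \<xi> where "\<xi> = (\<lambda>\<omega>. t * indicat_real D \<omega>)"
        have DF: "indicat_real D \<in> F" using D by (auto intro: ind)
        then have "\<xi> \<in> F" using function_ideal_scale[OF ideal] by (simp add: \<xi>_def)
        moreover have "nrm \<xi> = 1"
          unfolding \<xi>_def ri_norm_scale[OF ri DF] using D t by simp
        moreover have "{\<omega> \<in> space M. t \<le> \<bar>\<xi> \<omega>\<bar>} = D"
          using t sets.sets_into_space[OF D(1)] by (auto simp: \<xi>_def indicator_def split: if_splits)
        ultimately have "emeasure M D \<le> tchebychev_char M F nrm t"
          unfolding tchebychev_char_def by (intro SUP_upper2[of \<xi>]) (auto simp: tail_fun_def)
        then have "ennreal (1 / s) \<le> tchebychev_char M F nrm t"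
          using A D by simp
        moreover have "1 / ennreal (1 / s) = ennreal s"
          using s by (simp flip: ennreal_1 add: divide_ennreal)
        ultimately show "1 / tchebychev_char M F nrm t \<le> ennreal s"
          by (metis ennreal_le_one_divide_iff one_divide_one_divide_ennreal)
      qed
    qed
  qed (use nB in auto)
qed

lemma regular_ri_imp_weakly_regular_ri: "regular_ri M F nrm \<Longrightarrow> weakly_regular_ri M F nrm"
  unfolding regular_ri_def weakly_regular_ri_def
  by (metis ennreal_1 mult_1 order_refl zero_less_one)

subsection \<open>Completeness from the Fatou property\<close>

lemma ri_norm_zero: "ri_norm M F nrm \<Longrightarrow> (\<lambda>_. 0) \<in> F \<Longrightarrow> nrm (\<lambda>_. 0) = 0"
  using ri_norm_scale[of M F nrm "\<lambda>_. 0" 0] by simp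

lemma fatou_propertyD:
  assumes "fatou_property M F nrm" "\<And>n. f n \<in> F" "\<xi> \<in> borel_measurable M"
    and "AE \<omega> in M. 0 \<le> f 0 \<omega> \<and> incseq (\<lambda>n. f n \<omega>) \<and> (\<lambda>n. f n \<omega>) \<longlonglongrightarrow> \<xi> \<omega>"
    and "bdd_above (range (\<lambda>n. nrm (f n)))"
  shows "\<xi> \<in> F \<and> (\<lambda>n. nrm (f n)) \<longlonglongrightarrow> nrm \<xi>"
  using assms unfolding fatou_property_def by blast

text \<open>Countable subadditivity in the manner of Riesz and Fischer. Local integrability makes
  the series of absolute values integrable on sets of finite measure, hence finite almost everywhere
  along a countable cover; the Fatou property carries the norm bound from the partial sums to the
  series.\<close>

lemma (in sigma_finite_measure) ri_norm_suminf:
  assumes ideal: "function_ideal M F" and ri: "ri_norm M F nrm" and fatou: "fatou_property M F nrm"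
    and loc: "\<And>E. E \<in> sets M \<Longrightarrow> emeasure M E < \<infinity> \<Longrightarrow>
      \<exists>C\<ge>0. \<forall>\<xi>\<in>F. (\<integral>\<^sup>+\<omega>\<in>E. ennreal \<bar>\<xi> \<omega>\<bar> \<partial>M) \<le> ennreal (C * nrm \<xi>)"
    and d: "\<And>n::nat. d n \<in> F" and sum: "summable (\<lambda>n. nrm (d n))"
  shows "AE \<omega> in M. summable (\<lambda>n. \<bar>d n \<omega>\<bar>)"
    and "(\<lambda>\<omega>. \<Sum>n. \<bar>d n \<omega>\<bar>) \<in> F"
    and "nrm (\<lambda>\<omega>. \<Sum>n. \<bar>d n \<omega>\<bar>) \<le> (\<Sum>n. nrm (d n))"
proof -
  have dm [measurable]: "d n \<in> borel_measurable M" for n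
    using function_ideal_measurable[OF ideal d] .
  have nn: "0 \<le> nrm (d n)" for n using ri_norm_nonneg[OF ri d] .
  have E: "AE \<omega> in M. \<omega> \<in> E \<longrightarrow> summable (\<lambda>n. \<bar>d n \<omega>\<bar>)"
    if Em [measurable]: "E \<in> sets M" and fin: "emeasure M E < \<infinity>" for E
  proof -
    obtain C where C: "0 \<le> C" "\<And>\<xi>. \<xi> \<in> F \<Longrightarrow> (\<integral>\<^sup>+\<omega>\<in>E. ennreal \<bar>\<xi> \<omega>\<bar> \<partial>M) \<le> ennreal (C * nrm \<xi>)"
      using loc[OF Em fin] by blast
    have "(\<integral>\<^sup>+\<omega>. (\<Sum>n. ennreal \<bar>d n \<omega>\<bar> * indicator E \<omega>) \<partial>M) =
        (\<Sum>n. \<integral>\<^sup>+\<omega>\<in>E. ennreal \<bar>d n \<omega>\<bar> \<partial>M)"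
      by (rule nn_integral_suminf) measurable
    also have "\<dots> \<le> (\<Sum>n. ennreal (C * nrm (d n)))"
      using C(2)[OF d] by (intro suminf_le) auto
    also have "\<dots> = ennreal (\<Sum>n. C * nrm (d n))"
      using C nn sum by (intro suminf_ennreal2) (auto intro: summable_mult)
    finally have "(\<integral>\<^sup>+\<omega>. (\<Sum>n. ennreal \<bar>d n \<omega>\<bar> * indicator E \<omega>) \<partial>M) \<noteq> \<infinity>"
      by (auto simp: top_unique)
    then have "AE \<omega> in M. (\<Sum>n. ennreal \<bar>d n \<omega>\<bar> * indicator E \<omega>) \<noteq> \<infinity>"
      by (intro nn_integral_PInf_AE) auto
    then show ?thesis
    proof eventually_elim
      fix \<omega> assume *: "(\<Sum>n. ennreal \<bar>d n \<omega>\<bar> * indicator E \<omega>) \<noteq> \<infinity>"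
      show "\<omega> \<in> E \<longrightarrow> summable (\<lambda>n. \<bar>d n \<omega>\<bar>)"
        using * by (auto intro!: summable_suminf_not_top)
    qed
  qed
  obtain A :: "nat \<Rightarrow> 'a set" where A: "range A \<subseteq> sets M" "(\<Union>i. A i) = space M"
      "\<And>i. emeasure M (A i) \<noteq> \<infinity>"
    using sigma_finite by blast
  have "AE \<omega> in M. \<forall>i. \<omega> \<in> A i \<longrightarrow> summable (\<lambda>n. \<bar>d n \<omega>\<bar>)"
    unfolding AE_all_countable
  proof
    show "AE \<omega> in M. \<omega> \<in> A i \<longrightarrow> summable (\<lambda>n. \<bar>d n \<omega>\<bar>)" for i
      using E[of "A i"] A(1) A(3)[of i] by (auto simp: less_top)
  qed
  with AE_space show AE: "AE \<omega> in M. summable (\<lambda>n. \<bar>d n \<omega>\<bar>)"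
  proof eventually_elim
    fix \<omega> assume "\<omega> \<in> space M" "\<forall>i. \<omega> \<in> A i \<longrightarrow> summable (\<lambda>n. \<bar>d n \<omega>\<bar>)"
    then show "summable (\<lambda>n. \<bar>d n \<omega>\<bar>)" using A(2) by blast
  qed
  define p where "p m \<omega> = (\<Sum>n<m. \<bar>d n \<omega>\<bar>)" for m \<omega>
  have p: "p m \<in> F \<and> nrm (p m) \<le> (\<Sum>n<m. nrm (d n))" for m
  proof (induction m)
    case 0
    then show ?case
      using function_ideal_zero[OF ideal] ri_norm_zero[OF ri] by (simp add: p_def[abs_def])
  next
    case (Suc m)
    have a: "(\<lambda>\<omega>. \<bar>d m \<omega>\<bar>) \<in> F"
      by (rule function_ideal_mono[OF ideal d[of m]]) auto
    have "p (Suc m) = (\<lambda>\<omega>. p m \<omega> + \<bar>d m \<omega>\<bar>)" by (simp add: p_def fun_eq_iff)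
    moreover have "nrm (\<lambda>\<omega>. \<bar>d m \<omega>\<bar>) \<le> nrm (d m)"
      by (rule ri_norm_mono[OF ri d a]) auto
    ultimately show ?case
      using Suc a function_ideal_add[OF ideal _ a] ri_norm_triangle[OF ri _ a, of "p m"] by auto
  qed
  have bound: "nrm (p m) \<le> (\<Sum>n. nrm (d n))" for m
    using p[of m] sum_le_suminf[OF sum, of "{..<m}"] nn by fastforce
  \<comment> \<open>At points of divergence \<open>suminf\<close> has no specified value. They form
    a null set, which the almost everywhere form of the Fatou property tolerates.\<close>
  have "(\<lambda>\<omega>. \<Sum>n. \<bar>d n \<omega>\<bar>) \<in> F \<and> (\<lambda>m. nrm (p m)) \<longlonglongrightarrow> nrm (\<lambda>\<omega>. \<Sum>n. \<bar>d n \<omega>\<bar>)"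
  proof (rule fatou_propertyD[OF fatou])
    show "(\<lambda>\<omega>. \<Sum>n. \<bar>d n \<omega>\<bar>) \<in> borel_measurable M" by measurable
    show "p m \<in> F" for m using p by blast
    show "AE \<omega> in M. 0 \<le> p 0 \<omega> \<and> incseq (\<lambda>m. p m \<omega>) \<and> (\<lambda>m. p m \<omega>) \<longlonglongrightarrow> (\<Sum>n. \<bar>d n \<omega>\<bar>)"
      using AE
    proof eventually_elim
      fix \<omega> assume "summable (\<lambda>n. \<bar>d n \<omega>\<bar>)"
      then have "(\<lambda>m. p m \<omega>) \<longlonglongrightarrow> (\<Sum>n. \<bar>d n \<omega>\<bar>)"
        unfolding p_def by (rule summable_LIMSEQ)
      then show "0 \<le> p 0 \<omega> \<and> incseq (\<lambda>m. p m \<omega>) \<and> (\<lambda>m. p m \<omega>) \<longlonglongrightarrow> (\<Sum>n. \<bar>d n \<omega>\<bar>)"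
        by (auto simp: p_def intro: incseq_SucI)
    qed
    show "bdd_above (range (\<lambda>m. nrm (p m)))" using bound by (intro bdd_aboveI2)
  qed
  then show "(\<lambda>\<omega>. \<Sum>n. \<bar>d n \<omega>\<bar>) \<in> F" and "nrm (\<lambda>\<omega>. \<Sum>n. \<bar>d n \<omega>\<bar>) \<le> (\<Sum>n. nrm (d n))"
    using bound by (auto intro: LIMSEQ_le_const2)
qed

text \<open>Along a subsequence the increments have geometrically small norms, so their series
  converges almost everywhere and its absolute tails dominate the distance to the limit. The Cauchy
  property extends convergence to the full sequence.\<close>

lemma (in sigma_finite_measure) complete_normI_fatou:
  assumes ideal: "function_ideal M F" and ri: "ri_norm M F nrm" and fatou: "fatou_property M F nrm"
    and loc: "\<And>E. E \<in> sets M \<Longrightarrow> emeasure M E < \<infinity> \<Longrightarrow>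
      \<exists>C\<ge>0. \<forall>\<xi>\<in>F. (\<integral>\<^sup>+\<omega>\<in>E. ennreal \<bar>\<xi> \<omega>\<bar> \<partial>M) \<le> ennreal (C * nrm \<xi>)"
  shows "complete_norm F nrm"
  unfolding complete_norm_def
proof (intro allI impI, elim conjE)
  fix f :: "nat \<Rightarrow> 'a \<Rightarrow> real"
  assume f: "\<forall>n. f n \<in> F" and cauchy: "\<forall>e>0. \<exists>K. \<forall>m\<ge>K. \<forall>n\<ge>K. nrm (\<lambda>\<omega>. f m \<omega> - f n \<omega>) < e"
  have fm [measurable]: "f n \<in> borel_measurable M" for n
    using function_ideal_measurable[OF ideal] f by blast
  have "\<exists>K. \<forall>m\<ge>K. \<forall>n\<ge>K. nrm (\<lambda>\<omega>. f m \<omega> - f n \<omega>) < (1 / 2) ^ k" for k :: nat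
    using cauchy by simp
  then obtain K where K: "\<And>k m n. K k \<le> m \<Longrightarrow> K k \<le> n \<Longrightarrow> nrm (\<lambda>\<omega>. f m \<omega> - f n \<omega>) < (1 / 2) ^ k"
    by metis
  \<comment> \<open>Summing the thresholds gives a nondecreasing index that is at least
    \<open>K k\<close> at each k.\<close>
  define r where "r k = (\<Sum>i\<le>k. K i)" for k
  have r: "K k \<le> r k" "r k \<le> r (Suc k)" for k
    unfolding r_def by (auto intro: member_le_sum)
  define d where "d k \<omega> = f (r (Suc k)) \<omega> - f (r k) \<omega>" for k \<omega>
  have d: "d k \<in> F" for k
    unfolding d_def[abs_def] using f by (intro function_ideal_diff[OF ideal]) auto
  have dm [measurable]: "d k \<in> borel_measurable M" for k
    using function_ideal_measurable[OF ideal d] .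
  have nd: "nrm (d k) \<le> (1 / 2) ^ k" for k
    unfolding d_def[abs_def] using K[of k "r (Suc k)" "r k"] r[of k] by simp
  have nn: "0 \<le> nrm (d k)" for k using ri_norm_nonneg[OF ri d] .
  have geo: "summable (\<lambda>k. (1 / 2 :: real) ^ (k + j))" "(\<Sum>k. (1 / 2 :: real) ^ (k + j)) = 2 * (1 / 2) ^ j" for j
    using summable_mult2[OF summable_geometric[of "1 / 2 :: real"], of "(1 / 2) ^ j"]
      suminf_mult2[OF summable_geometric[of "1 / 2 :: real"], of "(1 / 2) ^ j"]
      suminf_geometric[of "1 / 2 :: real"]
    by (auto simp: power_add)
  have sums: "summable (\<lambda>k. nrm (d (k + j)))" for j
    using nd nn by (intro summable_comparison_test'[OF geo(1)[of j]]) auto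
  \<comment> \<open>\<open>T j\<close> will majorise the distance from \<open>f (r j)\<close> to the
    limit; the geometric series bounds its norm by 2 (1 / 2)^j.\<close>
  define T where "T j \<omega> = (\<Sum>k. \<bar>d (k + j) \<omega>\<bar>)" for j \<omega>
  have T: "T j \<in> F" "nrm (T j) \<le> 2 * (1 / 2) ^ j" for j
  proof -
    have "nrm (T j) \<le> (\<Sum>k. nrm (d (k + j)))"
      unfolding T_def[abs_def] by (rule ri_norm_suminf(3)[OF ideal ri fatou loc d sums])
    also have "\<dots> \<le> (\<Sum>k. (1 / 2) ^ (k + j))"
      using nd sums geo by (intro suminf_le) auto
    finally show "nrm (T j) \<le> 2 * (1 / 2) ^ j" using geo by simp
    show "T j \<in> F"
      unfolding T_def[abs_def] by (rule ri_norm_suminf(2)[OF ideal ri fatou loc d sums])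
  qed
  have AE: "AE \<omega> in M. summable (\<lambda>k. \<bar>d k \<omega>\<bar>)"
    using ri_norm_suminf(1)[OF ideal ri fatou loc d sums[of 0, simplified]] .
  define \<xi> where "\<xi> \<omega> = f (r 0) \<omega> + (\<Sum>k. d k \<omega>)" for \<omega>
  have \<xi>m [measurable]: "\<xi> \<in> borel_measurable M" unfolding \<xi>_def[abs_def] by measurable
  have close: "AE \<omega> in M. \<bar>f (r j) \<omega> - \<xi> \<omega>\<bar> \<le> \<bar>T j \<omega>\<bar>" for j
    using AE
  proof eventually_elim
    fix \<omega> assume abs: "summable (\<lambda>k. \<bar>d k \<omega>\<bar>)"
    then have s: "summable (\<lambda>k. d k \<omega>)" by (rule summable_rabs_cancel)
    have "(\<Sum>k<j. d k \<omega>) = f (r j) \<omega> - f (r 0) \<omega>"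
      unfolding d_def by (rule sum_lessThan_telescope)
    then have "\<xi> \<omega> - f (r j) \<omega> = (\<Sum>k. d (k + j) \<omega>)"
      unfolding \<xi>_def using suminf_split_initial_segment[OF s, of j] by simp
    moreover have absj: "summable (\<lambda>k. \<bar>d (k + j) \<omega>\<bar>)"
      using summable_ignore_initial_segment[OF abs] .
    ultimately show "\<bar>f (r j) \<omega> - \<xi> \<omega>\<bar> \<le> \<bar>T j \<omega>\<bar>"
      using summable_rabs[OF absj] by (simp add: T_def)
  qed
  have diffF: "(\<lambda>\<omega>. f (r j) \<omega> - \<xi> \<omega>) \<in> F" for j
    by (rule function_ideal_mono[OF ideal T(1) _ close]) measurable
  \<comment> \<open>The limit is \<open>f (r 0)\<close> minus the difference just shown to lie in
    \<open>F\<close>.\<close>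
  have \<xi>: "\<xi> \<in> F"
    using function_ideal_diff[OF ideal _ diffF[of 0], of "f (r 0)"] f by simp
  \<comment> \<open>The factor 3 is 1 from the Cauchy bound between \<open>f n\<close> and
    \<open>f (r j)\<close> plus 2 from the norm of \<open>T j\<close>.\<close>
  have est: "nrm (\<lambda>\<omega>. f n \<omega> - \<xi> \<omega>) \<le> 3 * (1 / 2) ^ j" if "r j \<le> n" for n j
  proof -
    have nF: "(\<lambda>\<omega>. f n \<omega> - f (r j) \<omega>) \<in> F"
      using f by (intro function_ideal_diff[OF ideal]) auto
    have "nrm (\<lambda>\<omega>. f n \<omega> - \<xi> \<omega>) \<le> nrm (\<lambda>\<omega>. f n \<omega> - f (r j) \<omega>) + nrm (\<lambda>\<omega>. f (r j) \<omega> - \<xi> \<omega>)"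
      using ri_norm_triangle[OF ri nF diffF[of j]] by simp
    also have "nrm (\<lambda>\<omega>. f n \<omega> - f (r j) \<omega>) \<le> (1 / 2) ^ j"
      using K[of j n "r j"] r(1)[of j] that by simp
    also have "nrm (\<lambda>\<omega>. f (r j) \<omega> - \<xi> \<omega>) \<le> nrm (T j)"
      using close by (rule ri_norm_mono[OF ri T(1) diffF])
    also have "nrm (T j) \<le> 2 * (1 / 2) ^ j" by (rule T)
    finally show ?thesis by simp
  qed
  have "(\<lambda>n. nrm (\<lambda>\<omega>. f n \<omega> - \<xi> \<omega>)) \<longlonglongrightarrow> 0"
  proof (rule LIMSEQ_I)
    fix e :: real assume "0 < e"
    then obtain j where j: "(1 / 2) ^ j < e / 3"
      using real_arch_pow_inv[of "e / 3" "1 / 2"] by auto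
    have "norm (nrm (\<lambda>\<omega>. f n \<omega> - \<xi> \<omega>) - 0) < e" if "r j \<le> n" for n
    proof -
      have "(\<lambda>\<omega>. f n \<omega> - \<xi> \<omega>) \<in> F"
        using f \<xi> by (intro function_ideal_diff[OF ideal]) auto
      from ri_norm_nonneg[OF ri this] est[OF that] j show ?thesis by simp
    qed
    then show "\<exists>no. \<forall>n\<ge>no. norm (nrm (\<lambda>\<omega>. f n \<omega> - \<xi> \<omega>) - 0) < e" by blast
  qed
  with \<xi> show "\<exists>\<xi>\<in>F. (\<lambda>n. nrm (\<lambda>\<omega>. f n \<omega> - \<xi> \<omega>)) \<longlonglongrightarrow> 0" by blast
qed

subsection \<open>Orlicz spaces\<close>

text \<open>Write u(\<omega>) as the length of (0, u(\<omega>)] and exchange the integrals. Modulars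
  thereby become functions of tails, which gives rearrangement invariance of the Luxemburg
  norm.\<close>

lemma (in sigma_finite_measure) nn_integral_layer_cake:
  fixes u :: "'a \<Rightarrow> real"
  assumes [measurable]: "u \<in> borel_measurable M" and nn: "\<And>\<omega>. 0 \<le> u \<omega>"
  shows "(\<integral>\<^sup>+\<omega>. ennreal (u \<omega>) \<partial>M) =
    (\<integral>\<^sup>+s. indicator {0<..} s * emeasure M {\<omega> \<in> space M. s \<le> u \<omega>} \<partial>lborel)"
proof -
  interpret pair_sigma_finite M lborel ..
  have "(\<integral>\<^sup>+\<omega>. ennreal (u \<omega>) \<partial>M) =
      (\<integral>\<^sup>+\<omega>. (\<integral>\<^sup>+s. indicator {0<..} s * (if s \<le> u \<omega> then 1 else 0) \<partial>lborel) \<partial>M)"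
  proof (rule nn_integral_cong)
    fix \<omega>
    have "(\<lambda>s. indicator {0<..} s * (if s \<le> u \<omega> then 1 else 0)) = (indicator {0<..u \<omega>} :: real \<Rightarrow> ennreal)"
      by (auto simp: indicator_def fun_eq_iff)
    then show "ennreal (u \<omega>) = (\<integral>\<^sup>+s. indicator {0<..} s * (if s \<le> u \<omega> then 1 else 0) \<partial>lborel)"
      using nn[of \<omega>] by simp
  qed
  also have "\<dots> = (\<integral>\<^sup>+s. (\<integral>\<^sup>+\<omega>. indicator {0<..} s * (if s \<le> u \<omega> then 1 else 0) \<partial>M) \<partial>lborel)"
    by (rule Fubini'[symmetric]) measurable
  also have "\<dots> = (\<integral>\<^sup>+s. indicator {0<..} s * emeasure M {\<omega> \<in> space M. s \<le> u \<omega>} \<partial>lborel)"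
  proof (rule nn_integral_cong)
    fix s :: real
    have "(\<integral>\<^sup>+\<omega>. indicator {0<..} s * (if s \<le> u \<omega> then 1 else 0) \<partial>M) =
        (\<integral>\<^sup>+\<omega>. indicator {0<..} s * indicator {\<omega> \<in> space M. s \<le> u \<omega>} \<omega> \<partial>M)"
      by (rule nn_integral_cong) (auto simp: indicator_def)
    also have "\<dots> = indicator {0<..} s * emeasure M {\<omega> \<in> space M. s \<le> u \<omega>}"
      by (simp add: nn_integral_cmult)
    finally show "(\<integral>\<^sup>+\<omega>. indicator {0<..} s * (if s \<le> u \<omega> then 1 else 0) \<partial>M) =
        indicator {0<..} s * emeasure M {\<omega> \<in> space M. s \<le> u \<omega>}" .
  qed
  finally show ?thesis .
qed

locale orlicz = sigma_finite_measure M for M :: "'a measure" +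
  fixes N :: "real \<Rightarrow> real"
  assumes young: "young_function N"
    and cont: "continuous_on {0..} N"
    and strict: "strict_mono_on {0..} N"
begin

abbreviation "lux \<equiv> luxemburg_set M N"
abbreviation "nrm \<equiv> luxemburg_norm M N"
abbreviation "Or \<equiv> orlicz_space M N"

section \<open>Elementary properties of the Young function\<close>

lemma N_0 [simp]: "N 0 = 0" and N_nonneg: "0 \<le> u \<Longrightarrow> 0 \<le> N u"
  using young by (auto simp: young_function_def)

lemma N_mono: "0 \<le> u \<Longrightarrow> u \<le> v \<Longrightarrow> N u \<le> N v"
  using strict_mono_onD[OF strict, of u v] by (cases "u = v") auto

lemma N_le_iff: "0 \<le> u \<Longrightarrow> 0 \<le> v \<Longrightarrow> N u \<le> N v \<longleftrightarrow> u \<le> v"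
  using strict_mono_on_leD[OF strict, of u v] strict_mono_onD[OF strict, of v u]
  by (metis N_mono atLeast_iff not_le)

lemma N_pos: "0 < u \<Longrightarrow> 0 < N u"
  using strict_mono_onD[OF strict, of 0 u] by simp

lemma N_convex:
  assumes "0 \<le> u" "0 \<le> v" "0 \<le> a" "0 \<le> b" "a + b = 1"
  shows "N (a * u + b * v) \<le> a * N u + b * N v"
proof -
  have a: "a = 1 - b" using assms(5) by simp
  then show ?thesis
    using young assms(1-4) convex_onD[of "{0..}" N b u v] by (simp add: young_function_def)
qed

lemma N_mult_le: "0 \<le> u \<Longrightarrow> 0 \<le> a \<Longrightarrow> a \<le> 1 \<Longrightarrow> N (a * u) \<le> a * N u"
  using N_convex[of u 0 a "1 - a"] by simp

lemma N_tendsto: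
  assumes "(f \<longlongrightarrow> l) F" "\<And>x. 0 \<le> f x" "0 \<le> l"
  shows "((\<lambda>x. N (f x)) \<longlongrightarrow> N l) F"
  using assms by (intro continuous_on_tendsto_compose[OF cont]) auto

text \<open>Continuity of \<open>N\<close> is given on [0, infinity) only; composition with the
  absolute value is continuous on the whole line.\<close>

lemma N_measurable [measurable (raw)]:
  assumes [measurable]: "f \<in> borel_measurable L"
  shows "(\<lambda>\<omega>. N \<bar>f \<omega>\<bar>) \<in> borel_measurable L"
proof -
  have "continuous_on UNIV (\<lambda>x::real. N \<bar>x\<bar>)"
    by (intro continuous_on_compose2[OF cont]) (auto intro!: continuous_intros)
  then have "(\<lambda>x. N \<bar>x\<bar>) \<in> borel_measurable borel"
    by (rule borel_measurable_continuous_onI)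
  from measurable_compose[OF assms this] show ?thesis .
qed

lemma N_div_measurable:
  assumes [measurable]: "\<xi> \<in> borel_measurable M" and "0 < k"
  shows "(\<lambda>\<omega>. N (\<bar>\<xi> \<omega>\<bar> / k)) \<in> borel_measurable M"
proof -
  have "(\<lambda>\<omega>. N \<bar>\<xi> \<omega> / k\<bar>) \<in> borel_measurable M" by measurable
  then show ?thesis using assms(2) by (simp add: abs_divide)
qed

text \<open>The intermediate value theorem between 0 and a point where \<open>N\<close> has passed
  s; such a point exists because \<open>N\<close> tends to infinity.\<close>

lemma N_surj:
  assumes "0 < s"
  obtains v where "0 < v" "N v = s"
proof -
  have "eventually (\<lambda>u. s \<le> N u) at_top" "eventually (\<lambda>u::real. 0 \<le> u) at_top"
    using young by (auto simp: young_function_def filterlim_at_top eventually_ge_at_top)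
  then have "eventually (\<lambda>u. s \<le> N u \<and> 0 \<le> u) at_top"
    by eventually_elim auto
  then obtain u where u: "s \<le> N u" "0 \<le> u"
    using eventually_happens by force
  have "continuous_on {0..u} N"
    using continuous_on_subset[OF cont] by auto
  then obtain v where "0 \<le> v" "N v = s"
    using IVT'[of N 0 s u] u assms by auto
  with assms that[of v] show ?thesis by (cases "v = 0") auto
qed

section \<open>The set of admissible Luxemburg parameters\<close>

lemma luxemburg_set_pos: "k \<in> lux \<xi> \<Longrightarrow> 0 < k"
  by (simp add: luxemburg_set_def)

lemma luxemburg_set_mono:
  assumes "k \<in> lux \<xi>" "k \<le> j" "AE \<omega> in M. \<bar>\<eta> \<omega>\<bar> \<le> \<bar>\<xi> \<omega>\<bar>"
  shows "j \<in> lux \<eta>"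
proof -
  have k: "0 < k" "(\<integral>\<^sup>+\<omega>. ennreal (N (\<bar>\<xi> \<omega>\<bar> / k)) \<partial>M) \<le> 1"
    using assms by (auto simp: luxemburg_set_def)
  have "(\<integral>\<^sup>+\<omega>. ennreal (N (\<bar>\<eta> \<omega>\<bar> / j)) \<partial>M) \<le> (\<integral>\<^sup>+\<omega>. ennreal (N (\<bar>\<xi> \<omega>\<bar> / k)) \<partial>M)"
    using assms(3) by (intro nn_integral_mono_AE, eventually_elim)
      (use k assms(2) in \<open>auto intro!: ennreal_leI N_mono frac_le\<close>)
  then show ?thesis
    using k assms(2) by (auto simp: luxemburg_set_def)
qed

text \<open>Fatou's lemma combined with continuity of \<open>N\<close>. A constant sequence u with
  varying k shows that a positive infimum is attained; constant k with increasing u leads to the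
  Fatou property.\<close>

lemma luxemburg_set_limit:
  assumes [measurable]: "\<And>n::nat. u n \<in> borel_measurable M"
    and lim: "AE \<omega> in M. (\<lambda>n. u n \<omega>) \<longlonglongrightarrow> \<xi> \<omega>" and k: "k \<longlonglongrightarrow> l" "0 < l"
    and mem: "\<And>n. k n \<in> lux (u n)"
  shows "l \<in> lux \<xi>"
proof -
  have kpos: "0 < k n" for n using mem luxemburg_set_pos by blast
  have "(\<integral>\<^sup>+\<omega>. ennreal (N (\<bar>\<xi> \<omega>\<bar> / l)) \<partial>M) =
      (\<integral>\<^sup>+\<omega>. liminf (\<lambda>n. ennreal (N (\<bar>u n \<omega>\<bar> / k n))) \<partial>M)"
  proof (rule nn_integral_cong_AE, use lim in eventually_elim)
    fix \<omega> assume "(\<lambda>n. u n \<omega>) \<longlonglongrightarrow> \<xi> \<omega>"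
    then have "(\<lambda>n. \<bar>u n \<omega>\<bar> / k n) \<longlonglongrightarrow> \<bar>\<xi> \<omega>\<bar> / l"
      using k by (intro tendsto_intros) auto
    then have "(\<lambda>n. N (\<bar>u n \<omega>\<bar> / k n)) \<longlonglongrightarrow> N (\<bar>\<xi> \<omega>\<bar> / l)"
      by (rule N_tendsto) (use k kpos in \<open>auto simp: less_imp_le\<close>)
    then have "(\<lambda>n. ennreal (N (\<bar>u n \<omega>\<bar> / k n))) \<longlonglongrightarrow> ennreal (N (\<bar>\<xi> \<omega>\<bar> / l))"
      by (rule tendsto_ennrealI)
    then show "ennreal (N (\<bar>\<xi> \<omega>\<bar> / l)) = liminf (\<lambda>n. ennreal (N (\<bar>u n \<omega>\<bar> / k n)))"
      by (simp add: lim_imp_Liminf)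
  qed
  also have "\<dots> \<le> liminf (\<lambda>n. \<integral>\<^sup>+\<omega>. ennreal (N (\<bar>u n \<omega>\<bar> / k n)) \<partial>M)"
    using N_div_measurable kpos by (intro nn_integral_liminf) auto
  also have "\<dots> \<le> limsup (\<lambda>n. \<integral>\<^sup>+\<omega>. ennreal (N (\<bar>u n \<omega>\<bar> / k n)) \<partial>M)"
    by (rule Liminf_le_Limsup) simp
  also have "\<dots> \<le> 1"
    using mem by (intro Limsup_bounded) (auto simp: luxemburg_set_def)
  finally show ?thesis using k by (simp add: luxemburg_set_def)
qed

lemma luxemburg_norm_le: "k \<in> lux \<xi> \<Longrightarrow> nrm \<xi> \<le> k"
  unfolding luxemburg_norm_def
  by (intro cInf_lower bdd_belowI[of _ 0]) (auto dest: luxemburg_set_pos)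

lemma orlicz_spaceD: "\<xi> \<in> Or \<Longrightarrow> \<xi> \<in> borel_measurable M"
  by (simp add: orlicz_space_def)

lemma orlicz_spaceI: "\<xi> \<in> borel_measurable M \<Longrightarrow> k \<in> lux \<xi> \<Longrightarrow> \<xi> \<in> Or"
  by (auto simp: orlicz_space_def)

lemma orlicz_spaceE:
  assumes "\<xi> \<in> Or"
  obtains k where "k \<in> lux \<xi>"
  using assms by (auto simp: orlicz_space_def)

lemma luxemburg_norm_nonneg: "\<xi> \<in> Or \<Longrightarrow> 0 \<le> nrm \<xi>"
  unfolding luxemburg_norm_def orlicz_space_def
  by (auto intro!: cInf_greatest dest: luxemburg_set_pos)

text \<open>The parameters k + 1 / (n + 1) exceed the norm and are therefore admissible; the limit
  lemma then admits k itself. Norm estimates thus become membership statements.\<close>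

lemma luxemburg_set_iff:
  assumes "\<xi> \<in> Or"
  shows "k \<in> lux \<xi> \<longleftrightarrow> 0 < k \<and> nrm \<xi> \<le> k"
proof (intro iffI conjI)
  assume k: "0 < k \<and> nrm \<xi> \<le> k"
  have "k + 1 / real (Suc n) \<in> lux \<xi>" for n
  proof -
    have "nrm \<xi> < k + 1 / real (Suc n)"
      using k by (smt (verit) of_nat_0_less_iff zero_less_Suc zero_less_divide_1_iff)
    then obtain j where "j \<in> lux \<xi>" "j < k + 1 / real (Suc n)"
      using assms cInf_lessD[of "lux \<xi>"] by (auto simp: orlicz_space_def luxemburg_norm_def)
    then show ?thesis using luxemburg_set_mono[of j \<xi> _ \<xi>] by simp
  qed
  moreover have "(\<lambda>n. k + 1 / real (Suc n)) \<longlonglongrightarrow> k + 0"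
    by (intro tendsto_intros LIMSEQ_Suc[OF lim_1_over_n])
  ultimately show "k \<in> lux \<xi>"
    using k luxemburg_set_limit[where u = "\<lambda>_. \<xi>" and \<xi> = \<xi> and k = "\<lambda>n. k + 1 / real (Suc n)"]
      orlicz_spaceD[OF assms] by simp
next
  assume "k \<in> lux \<xi>"
  then show "0 < k" "nrm \<xi> \<le> k" by (rule luxemburg_set_pos, rule luxemburg_norm_le)
qed

lemma luxemburg_norm_leI:
  assumes "\<And>k. x < k \<Longrightarrow> k \<in> lux \<xi>"
  shows "nrm \<xi> \<le> x"
  by (rule dense_ge) (use assms luxemburg_norm_le in blast)

lemma luxemburg_set_zero: "0 < k \<Longrightarrow> k \<in> lux (\<lambda>_. 0)"
  by (simp add: luxemburg_set_def)

lemma luxemburg_set_scale: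
  assumes "k \<in> lux \<xi>" "a \<noteq> 0"
  shows "\<bar>a\<bar> * k \<in> lux (\<lambda>\<omega>. a * \<xi> \<omega>)"
  using assms by (auto simp: luxemburg_set_def abs_mult)

text \<open>(x + y) / (k + j) is the convex combination of x / k and y / j with weights k / (k + j)
  and j / (k + j), so convexity bounds the new modular by an average of two modulars that are at
  most 1.\<close>

lemma luxemburg_set_add:
  assumes k: "k \<in> lux \<xi>" and j: "j \<in> lux \<eta>"
    and [measurable]: "\<xi> \<in> borel_measurable M" "\<eta> \<in> borel_measurable M"
  shows "k + j \<in> lux (\<lambda>\<omega>. \<xi> \<omega> + \<eta> \<omega>)"
proof -
  have pos: "0 < k" "0 < j" using k j luxemburg_set_pos by blast+
  have pt: "N (\<bar>x + y\<bar> / (k + j)) \<le> k / (k + j) * N (\<bar>x\<bar> / k) + j / (k + j) * N (\<bar>y\<bar> / j)" for x y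
  proof -
    have eq: "k / (k + j) * (\<bar>x\<bar> / k) + j / (k + j) * (\<bar>y\<bar> / j) = (\<bar>x\<bar> + \<bar>y\<bar>) / (k + j)"
      using pos by (simp add: add_divide_distrib)
    have "N (\<bar>x + y\<bar> / (k + j)) \<le> N (k / (k + j) * (\<bar>x\<bar> / k) + j / (k + j) * (\<bar>y\<bar> / j))"
      unfolding eq using pos by (intro N_mono divide_right_mono abs_triangle_ineq) auto
    also have "\<dots> \<le> k / (k + j) * N (\<bar>x\<bar> / k) + j / (k + j) * N (\<bar>y\<bar> / j)"
      using pos by (intro N_convex) (auto simp flip: add_divide_distrib)
    finally show ?thesis .
  qed
  have "(\<integral>\<^sup>+\<omega>. ennreal (N (\<bar>\<xi> \<omega> + \<eta> \<omega>\<bar> / (k + j))) \<partial>M) \<le>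
      (\<integral>\<^sup>+\<omega>. ennreal (k / (k + j)) * ennreal (N (\<bar>\<xi> \<omega>\<bar> / k)) +
        ennreal (j / (k + j)) * ennreal (N (\<bar>\<eta> \<omega>\<bar> / j)) \<partial>M)"
    using pos pt N_nonneg
    by (intro nn_integral_mono) (auto simp flip: ennreal_mult ennreal_plus intro!: ennreal_leI)
  also have "\<dots> = ennreal (k / (k + j)) * (\<integral>\<^sup>+\<omega>. ennreal (N (\<bar>\<xi> \<omega>\<bar> / k)) \<partial>M) +
        ennreal (j / (k + j)) * (\<integral>\<^sup>+\<omega>. ennreal (N (\<bar>\<eta> \<omega>\<bar> / j)) \<partial>M)"
    using N_div_measurable[OF assms(3) pos(1)] N_div_measurable[OF assms(4) pos(2)]
    by (simp add: nn_integral_add nn_integral_cmult)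
  also have "\<dots> \<le> ennreal (k / (k + j)) * 1 + ennreal (j / (k + j)) * 1"
    using k j by (intro add_mono mult_left_mono) (auto simp: luxemburg_set_def)
  also have "\<dots> = 1"
    using pos by (simp flip: ennreal_plus add_divide_distrib)
  finally show ?thesis using pos by (simp add: luxemburg_set_def)
qed

section \<open>Ideal and norm properties of the Orlicz space\<close>

lemma orlicz_space_ideal: "function_ideal M Or"
  unfolding function_ideal_def
proof (intro conjI ballI allI impI subsetI)
  show "\<xi> \<in> borel_measurable M" if "\<xi> \<in> Or" for \<xi> using that by (rule orlicz_spaceD)
  show "(\<lambda>_. 0) \<in> Or" by (rule orlicz_spaceI[OF _ luxemburg_set_zero[of 1]]) auto
  show "(\<lambda>\<omega>. a * \<xi> \<omega>) \<in> Or" if \<xi>: "\<xi> \<in> Or" for \<xi> a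
  proof -
    note orlicz_spaceD[OF \<xi>, measurable]
    obtain k where k: "k \<in> lux \<xi>" using \<xi> by (rule orlicz_spaceE)
    show ?thesis
    proof (cases "a = 0")
      case True
      then show ?thesis using orlicz_spaceI[OF _ luxemburg_set_zero[of 1]] by simp
    next
      case False
      then show ?thesis using luxemburg_set_scale[OF k] by (intro orlicz_spaceI) auto
    qed
  qed
  show "(\<lambda>\<omega>. \<xi> \<omega> + \<eta> \<omega>) \<in> Or" if \<xi>: "\<xi> \<in> Or" "\<eta> \<in> Or" for \<xi> \<eta>
  proof -
    note \<xi>[THEN orlicz_spaceD, measurable]
    obtain k j where "k \<in> lux \<xi>" "j \<in> lux \<eta>" using \<xi> by (meson orlicz_spaceE)
    from luxemburg_set_add[OF this] show ?thesis by (intro orlicz_spaceI) auto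
  qed
  show "\<eta> \<in> Or" if "\<xi> \<in> Or" "\<eta> \<in> borel_measurable M" "AE \<omega> in M. \<bar>\<eta> \<omega>\<bar> \<le> \<bar>\<xi> \<omega>\<bar>" for \<xi> \<eta>
    using that luxemburg_set_mono by (meson order_refl orlicz_spaceE orlicz_spaceI)
qed

text \<open>As \<open>N\<close> is strictly increasing, the superlevel set of N(|\<xi>| / k) at the
  height N(v) is that of |\<xi>| at k v, and every positive height has this form. The layer cake
  formula then equates the modulars.\<close>

lemma luxemburg_set_equimeasurable:
  assumes [measurable]: "\<xi> \<in> borel_measurable M" "\<eta> \<in> borel_measurable M"
    and eq: "equimeasurable M \<xi> \<eta>"
  shows "lux \<xi> = lux \<eta>"
proof -
  have "(\<integral>\<^sup>+\<omega>. ennreal (N (\<bar>\<xi> \<omega>\<bar> / k)) \<partial>M) = (\<integral>\<^sup>+\<omega>. ennreal (N (\<bar>\<eta> \<omega>\<bar> / k)) \<partial>M)" if k: "0 < k" for k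
  proof -
    have tail: "emeasure M {\<omega> \<in> space M. s \<le> N (\<bar>\<zeta> \<omega>\<bar> / k)} = tail_fun M \<zeta> (k * v)"
      if "0 < v" "N v = s" for s v \<zeta>
    proof -
      have "s \<le> N (\<bar>x\<bar> / k) \<longleftrightarrow> k * v \<le> \<bar>x\<bar>" for x
        using N_le_iff[of v "\<bar>x\<bar> / k"] that k by (auto simp: field_simps)
      then show ?thesis by (simp add: tail_fun_def)
    qed
    have "indicator {0<..} s * emeasure M {\<omega> \<in> space M. s \<le> N (\<bar>\<xi> \<omega>\<bar> / k)} =
        indicator {0<..} s * emeasure M {\<omega> \<in> space M. s \<le> N (\<bar>\<eta> \<omega>\<bar> / k)}" for s
    proof (cases "0 < s")
      case True
      then obtain v where v: "0 < v" "N v = s" by (rule N_surj)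
      then show ?thesis
        using tail[OF v] eq k by (simp add: equimeasurable_def)
    qed auto
    then show ?thesis
      using N_div_measurable[OF assms(1) k] N_div_measurable[OF assms(2) k] k
      by (simp add: nn_integral_layer_cake N_nonneg)
  qed
  then show ?thesis by (auto simp: luxemburg_set_def)
qed

lemma luxemburg_norm_mono:
  assumes "\<xi> \<in> Or" "\<eta> \<in> Or" "AE \<omega> in M. \<bar>\<eta> \<omega>\<bar> \<le> \<bar>\<xi> \<omega>\<bar>"
  shows "nrm \<eta> \<le> nrm \<xi>"
proof (rule luxemburg_norm_leI)
  fix k assume "nrm \<xi> < k"
  then have "k \<in> lux \<xi>"
    using luxemburg_set_iff[OF assms(1)] luxemburg_norm_nonneg[OF assms(1)] by auto
  then show "k \<in> lux \<eta>" using luxemburg_set_mono[OF _ order_refl assms(3)] by blast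
qed

lemma luxemburg_norm_zero_iff:
  assumes \<xi>: "\<xi> \<in> Or"
  shows "nrm \<xi> = 0 \<longleftrightarrow> (AE \<omega> in M. \<xi> \<omega> = 0)"
proof
  assume z: "nrm \<xi> = 0"
  note orlicz_spaceD[OF \<xi>, measurable]
  have meas: "(\<lambda>\<omega>. N \<bar>\<xi> \<omega>\<bar>) \<in> borel_measurable M" by measurable
  let ?I = "\<integral>\<^sup>+\<omega>. ennreal (N \<bar>\<xi> \<omega>\<bar>) \<partial>M"
  \<comment> \<open>Norm 0 bounds the modular of \<xi> / e by 1, and convexity gives N(|\<xi>|)
    \<le> e N(|\<xi>| / e) for e \<le> 1. Letting e tend to 0 makes the modular vanish.\<close>
  have le: "?I \<le> ennreal e" if e: "0 < e" "e \<le> 1" for e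
  proof -
    have "?I \<le> (\<integral>\<^sup>+\<omega>. ennreal e * ennreal (N (\<bar>\<xi> \<omega>\<bar> / e)) \<partial>M)"
    proof (rule nn_integral_mono)
      fix \<omega>
      have "N (e * (\<bar>\<xi> \<omega>\<bar> / e)) \<le> e * N (\<bar>\<xi> \<omega>\<bar> / e)"
        using e by (intro N_mult_le) auto
      then show "ennreal (N \<bar>\<xi> \<omega>\<bar>) \<le> ennreal e * ennreal (N (\<bar>\<xi> \<omega>\<bar> / e))"
        using e N_nonneg by (simp flip: ennreal_mult add: ennreal_leI)
    qed
    also have "\<dots> = ennreal e * (\<integral>\<^sup>+\<omega>. ennreal (N (\<bar>\<xi> \<omega>\<bar> / e)) \<partial>M)"
      using N_div_measurable[of \<xi> e] e by (intro nn_integral_cmult) auto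
    also have "\<dots> \<le> ennreal e * 1"
      using luxemburg_set_iff[OF \<xi>, of e] z e
      by (intro mult_left_mono) (auto simp: luxemburg_set_def)
    finally show ?thesis by simp
  qed
  have "?I \<le> 0"
  proof (rule ennreal_le_epsilon)
    fix e :: real assume "0 < e"
    then have "?I \<le> ennreal (min e 1)" by (intro le) auto
    also have "\<dots> \<le> ennreal e" by (rule ennreal_leI) simp
    finally show "?I \<le> 0 + ennreal e" by simp
  qed
  then have "?I = 0" by simp
  then have "AE \<omega> in M. ennreal (N \<bar>\<xi> \<omega>\<bar>) = 0"
    using meas by (subst (asm) nn_integral_0_iff_AE) auto
  then show "AE \<omega> in M. \<xi> \<omega> = 0"
  proof eventually_elim
    fix \<omega> assume "ennreal (N \<bar>\<xi> \<omega>\<bar>) = 0"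
    then show "\<xi> \<omega> = 0" using N_pos[of "\<bar>\<xi> \<omega>\<bar>"] by (auto simp: ennreal_eq_0_iff)
  qed
next
  assume AE: "AE \<omega> in M. \<xi> \<omega> = 0"
  have "nrm \<xi> \<le> 0"
  proof (rule luxemburg_norm_leI)
    fix k :: real assume "0 < k"
    show "k \<in> lux \<xi>"
      by (rule luxemburg_set_mono[OF luxemburg_set_zero[OF \<open>0 < k\<close>]]) (use AE in auto)
  qed
  then show "nrm \<xi> = 0" using luxemburg_norm_nonneg[OF \<xi>] by simp
qed

lemma luxemburg_norm_scale_le:
  assumes \<xi>: "\<xi> \<in> Or"
  shows "nrm (\<lambda>\<omega>. a * \<xi> \<omega>) \<le> \<bar>a\<bar> * nrm \<xi>"
proof (rule luxemburg_norm_leI)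
  fix k assume k: "\<bar>a\<bar> * nrm \<xi> < k"
  have n: "0 \<le> nrm \<xi>" using \<xi> by (rule luxemburg_norm_nonneg)
  then have k0: "0 < k" using k by (auto intro: le_less_trans[rotated])
  show "k \<in> lux (\<lambda>\<omega>. a * \<xi> \<omega>)"
  proof (cases "a = 0")
    case True
    then show ?thesis using luxemburg_set_zero k0 by simp
  next
    case False
    then have "k / \<bar>a\<bar> \<in> lux \<xi>"
      using luxemburg_set_iff[OF \<xi>] k k0 by (simp add: field_simps)
    from luxemburg_set_scale[OF this False] show ?thesis using False by simp
  qed
qed

lemma luxemburg_norm_scale:
  assumes \<xi>: "\<xi> \<in> Or"
  shows "nrm (\<lambda>\<omega>. a * \<xi> \<omega>) = \<bar>a\<bar> * nrm \<xi>"
proof (cases "a = 0")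
  case True
  have "(\<lambda>\<omega>. a * \<xi> \<omega>) \<in> Or" using orlicz_space_ideal \<xi> by (simp add: function_ideal_def)
  from luxemburg_norm_nonneg[OF this] luxemburg_norm_scale_le[OF \<xi>, of a] True show ?thesis by simp
next
  case False
  have "(\<lambda>\<omega>. a * \<xi> \<omega>) \<in> Or" using orlicz_space_ideal \<xi> by (simp add: function_ideal_def)
  \<comment> \<open>The inequality with factor 1 / a, applied to a \<xi>, gives the reverse
    direction.\<close>
  from luxemburg_norm_scale_le[OF this, of "1 / a"] False
  have "\<bar>a\<bar> * nrm \<xi> \<le> nrm (\<lambda>\<omega>. a * \<xi> \<omega>)" by (simp add: field_simps)
  with luxemburg_norm_scale_le[OF \<xi>, of a] show ?thesis by simp
qed

lemma luxemburg_norm_triangle: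
  assumes \<xi>: "\<xi> \<in> Or" and \<eta>: "\<eta> \<in> Or"
  shows "nrm (\<lambda>\<omega>. \<xi> \<omega> + \<eta> \<omega>) \<le> nrm \<xi> + nrm \<eta>"
proof (rule luxemburg_norm_leI)
  fix k assume k: "nrm \<xi> + nrm \<eta> < k"
  \<comment> \<open>The slack is split evenly, so that both parameters are positive even when a norm
    is 0.\<close>
  define e where "e = (k - (nrm \<xi> + nrm \<eta>)) / 2"
  have e: "0 < e" "k = (nrm \<xi> + e) + (nrm \<eta> + e)" using k by (auto simp: e_def field_simps)
  have "nrm \<xi> + e \<in> lux \<xi>" "nrm \<eta> + e \<in> lux \<eta>"
    using luxemburg_set_iff \<xi> \<eta> e(1) luxemburg_norm_nonneg[OF \<xi>] luxemburg_norm_nonneg[OF \<eta>] by auto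
  then show "k \<in> lux (\<lambda>\<omega>. \<xi> \<omega> + \<eta> \<omega>)"
    unfolding e(2) using \<xi> \<eta> by (intro luxemburg_set_add) (auto dest: orlicz_spaceD)
qed

lemma luxemburg_ri_norm: "ri_norm M Or nrm"
  unfolding ri_norm_def
proof (intro conjI ballI allI impI)
  fix \<xi> \<eta> assume "\<xi> \<in> Or" "\<eta> \<in> Or" "equimeasurable M \<xi> \<eta>"
  then show "nrm \<eta> = nrm \<xi>"
    using luxemburg_set_equimeasurable[of \<xi> \<eta>] by (simp add: luxemburg_norm_def orlicz_spaceD)
qed (simp_all add: luxemburg_norm_nonneg luxemburg_norm_zero_iff luxemburg_norm_scale
    luxemburg_norm_triangle luxemburg_norm_mono)

section \<open>The Fatou property\<close>

text \<open>Every number above the supremum of the norms is admissible for each \<open>f n\<close>,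
  hence for the limit. Monotonicity of the norm gives the opposite inequality.\<close>

lemma luxemburg_fatou: "fatou_property M Or nrm"
  unfolding fatou_property_def
proof (intro allI ballI impI, elim conjE)
  fix f :: "nat \<Rightarrow> 'a \<Rightarrow> real" and \<xi>
  assume [measurable]: "\<xi> \<in> borel_measurable M" and f: "\<forall>n. f n \<in> Or"
    and AE: "AE \<omega> in M. 0 \<le> f 0 \<omega> \<and> incseq (\<lambda>n. f n \<omega>) \<and> (\<lambda>n. f n \<omega>) \<longlonglongrightarrow> \<xi> \<omega>"
    and bdd: "bdd_above (range (\<lambda>n. nrm (f n)))"
  have fm [measurable]: "f n \<in> borel_measurable M" for n by (rule orlicz_spaceD) (use f in simp)
  define S where "S = (SUP n. nrm (f n))"
  have S: "nrm (f n) \<le> S" for n unfolding S_def using bdd by (intro cSUP_upper) auto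
  have S0: "0 \<le> S" using S[of 0] luxemburg_norm_nonneg[of "f 0"] f by auto
  have K: "K \<in> lux \<xi>" if "S < K" for K
  proof (rule luxemburg_set_limit[OF fm, where k = "\<lambda>_. K"])
    show "AE \<omega> in M. (\<lambda>n. f n \<omega>) \<longlonglongrightarrow> \<xi> \<omega>" using AE by eventually_elim simp
    show "K \<in> lux (f n)" for n
      using f luxemburg_set_iff[of "f n" K] S[of n] S0 that by auto
  qed (use S0 that in auto)
  have \<xi>: "\<xi> \<in> Or" using K[of "S + 1"] by (intro orlicz_spaceI) auto
  have "nrm \<xi> \<le> S" using K by (rule luxemburg_norm_leI)
  have mono: "nrm (f m) \<le> nrm (f n)" if "m \<le> n" for m n
  proof (rule luxemburg_norm_mono)
    show "AE \<omega> in M. \<bar>f m \<omega>\<bar> \<le> \<bar>f n \<omega>\<bar>"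
      using AE
    proof eventually_elim
      fix \<omega> assume "0 \<le> f 0 \<omega> \<and> incseq (\<lambda>n. f n \<omega>) \<and> (\<lambda>n. f n \<omega>) \<longlonglongrightarrow> \<xi> \<omega>"
      then have "0 \<le> f 0 \<omega>" "f 0 \<omega> \<le> f m \<omega>" "f m \<omega> \<le> f n \<omega>"
        using that by (auto simp: incseq_def)
      then show "\<bar>f m \<omega>\<bar> \<le> \<bar>f n \<omega>\<bar>" by simp
    qed
  qed (use f in auto)
  have "nrm (f m) \<le> nrm \<xi>" for m
  proof (rule luxemburg_norm_mono[OF \<xi>])
    show "AE \<omega> in M. \<bar>f m \<omega>\<bar> \<le> \<bar>\<xi> \<omega>\<bar>"
      using AE
    proof eventually_elim
      fix \<omega> assume *: "0 \<le> f 0 \<omega> \<and> incseq (\<lambda>n. f n \<omega>) \<and> (\<lambda>n. f n \<omega>) \<longlonglongrightarrow> \<xi> \<omega>"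
      then have "0 \<le> f 0 \<omega>" "f 0 \<omega> \<le> f m \<omega>" "f m \<omega> \<le> \<xi> \<omega>"
        using incseq_le[of "\<lambda>n. f n \<omega>" "\<xi> \<omega>" m] by (auto simp: incseq_def)
      then show "\<bar>f m \<omega>\<bar> \<le> \<bar>\<xi> \<omega>\<bar>" by simp
    qed
  qed (use f in auto)
  then have "S \<le> nrm \<xi>" unfolding S_def by (intro cSUP_least) auto
  with \<open>nrm \<xi> \<le> S\<close> have "S = nrm \<xi>" by simp
  moreover have "(\<lambda>n. nrm (f n)) \<longlonglongrightarrow> S"
    unfolding S_def using mono by (intro LIMSEQ_incseq_SUP bdd) (auto simp: incseq_def)
  ultimately show "\<xi> \<in> Or \<and> (\<lambda>n. nrm (f n)) \<longlonglongrightarrow> nrm \<xi>" using \<xi> by simp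
qed

section \<open>Indicators and local integrability\<close>

lemma luxemburg_set_indicator:
  assumes "E \<in> sets M" "0 < k" "ennreal (N (1 / k)) * emeasure M E \<le> 1"
  shows "k \<in> lux (indicat_real E)"
proof -
  have "(\<integral>\<^sup>+\<omega>. ennreal (N (\<bar>indicat_real E \<omega>\<bar> / k)) \<partial>M) =
      (\<integral>\<^sup>+\<omega>. ennreal (N (1 / k)) * indicator E \<omega> \<partial>M)"
    by (rule nn_integral_cong) (simp add: indicator_def)
  then show ?thesis
    using assms by (simp add: luxemburg_set_def nn_integral_cmult_indicator)
qed

text \<open>The modular of an indicator divided by e is N(1 / e) times the measure, whence d = 1 /
  N(1 / e). This is the vanishing of the fundamental function at 0+ on which regularity
  rests.\<close>

lemma luxemburg_norm_indicator_small:
  assumes "0 < e"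
  shows "\<exists>d>0. \<forall>E\<in>sets M. emeasure M E \<le> ennreal d \<longrightarrow> nrm (indicat_real E) \<le> e"
proof (intro exI[of _ "1 / N (1 / e)"] conjI ballI impI)
  have p: "0 < N (1 / e)" using assms by (intro N_pos) simp
  then show "0 < 1 / N (1 / e)" by simp
  fix E assume E: "E \<in> sets M" "emeasure M E \<le> ennreal (1 / N (1 / e))"
  have "ennreal (N (1 / e)) * emeasure M E \<le> ennreal (N (1 / e)) * ennreal (1 / N (1 / e))"
    using E by (intro mult_left_mono) auto
  also have "\<dots> = 1" using p by (simp flip: ennreal_mult)
  finally show "nrm (indicat_real E) \<le> e"
    using E assms by (intro luxemburg_norm_le luxemburg_set_indicator) auto
qed

lemma indicator_in_orlicz_space:
  assumes E: "E \<in> sets M" "emeasure M E < \<infinity>"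
  shows "indicat_real E \<in> Or"
proof -
  obtain m where m: "emeasure M E = ennreal m" "0 \<le> m" using E by (cases "emeasure M E") auto
  \<comment> \<open>The summand 1 keeps the denominator positive for m = 0, and N(v) m \<le> 1 still
    holds.\<close>
  obtain v where v: "0 < v" "N v = 1 / (m + 1)" using N_surj[of "1 / (m + 1)"] m by auto
  have "N v * m \<le> 1" unfolding v(2) using m(2) by simp
  then have "ennreal (N v * m) \<le> ennreal 1" by (rule ennreal_leI)
  then have "ennreal (N v) * ennreal m \<le> 1"
    using N_nonneg[of v] v(1) m(2) by (simp add: ennreal_mult)
  then show ?thesis
    using v m E by (intro orlicz_spaceI[of _ "1 / v"] luxemburg_set_indicator) auto
qed

text \<open>Convexity makes \<open>N\<close> grow at least linearly beyond 1, so u \<le> 1 + N(u) /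
  N(1). With u = |\<xi>| / k and k the norm, integration over \<open>E\<close> gives k (m + 1 /
  N(1)).\<close>

lemma luxemburg_norm_local_integrable:
  assumes E: "E \<in> sets M" "emeasure M E < \<infinity>"
  shows "\<exists>C\<ge>0. \<forall>\<xi>\<in>Or. (\<integral>\<^sup>+\<omega>\<in>E. ennreal \<bar>\<xi> \<omega>\<bar> \<partial>M) \<le> ennreal (C * nrm \<xi>)"
proof -
  obtain m where m: "emeasure M E = ennreal m" "0 \<le> m" using E by (cases "emeasure M E") auto
  have N1: "0 < N 1" by (rule N_pos) simp
  have lin: "u \<le> 1 + N u / N 1" if "0 \<le> u" for u
  proof (cases "u \<le> 1")
    case True
    then show ?thesis using N_nonneg[OF that] N1 by (smt (verit) divide_nonneg_pos)
  next
    case False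
    then have "N 1 \<le> (1 / u) * N u" using N_mult_le[of u "1 / u"] by simp
    then have "u \<le> N u / N 1" using False N1 by (simp add: field_simps)
    then show ?thesis by simp
  qed
  define C where "C = m + 1 / N 1"
  have "(\<integral>\<^sup>+\<omega>\<in>E. ennreal \<bar>\<xi> \<omega>\<bar> \<partial>M) \<le> ennreal (C * nrm \<xi>)" if \<xi>: "\<xi> \<in> Or" for \<xi>
  proof (cases "nrm \<xi> = 0")
    case True
    then have "AE \<omega> in M. \<xi> \<omega> = 0" using luxemburg_norm_zero_iff[OF \<xi>] by simp
    then have "(\<integral>\<^sup>+\<omega>\<in>E. ennreal \<bar>\<xi> \<omega>\<bar> \<partial>M) = (\<integral>\<^sup>+\<omega>. 0 \<partial>M)"
      by (intro nn_integral_cong_AE) auto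
    then show ?thesis by simp
  next
    case False
    \<comment> \<open>A nonzero norm is itself an admissible parameter, so the modular at this k is
      at most 1.\<close>
    define k where "k = nrm \<xi>"
    have k: "0 < k" "k \<in> lux \<xi>"
      using False luxemburg_norm_nonneg[OF \<xi>] luxemburg_set_iff[OF \<xi>, of k] by (auto simp: k_def)
    note [measurable] = N_div_measurable[OF orlicz_spaceD[OF \<xi>] k(1)] E(1)
    have "(\<integral>\<^sup>+\<omega>\<in>E. ennreal \<bar>\<xi> \<omega>\<bar> \<partial>M) \<le>
        (\<integral>\<^sup>+\<omega>. ennreal k * indicator E \<omega> + ennreal (k / N 1) * ennreal (N (\<bar>\<xi> \<omega>\<bar> / k)) \<partial>M)"
    proof (rule nn_integral_mono)
      fix \<omega>
      have "\<bar>\<xi> \<omega>\<bar> / k \<le> 1 + N (\<bar>\<xi> \<omega>\<bar> / k) / N 1" using k by (intro lin) auto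
      then have "\<bar>\<xi> \<omega>\<bar> \<le> k + k / N 1 * N (\<bar>\<xi> \<omega>\<bar> / k)" using k N1 by (simp add: field_simps)
      then show "ennreal \<bar>\<xi> \<omega>\<bar> * indicator E \<omega> \<le>
          ennreal k * indicator E \<omega> + ennreal (k / N 1) * ennreal (N (\<bar>\<xi> \<omega>\<bar> / k))"
        using k N1 N_nonneg[of "\<bar>\<xi> \<omega>\<bar> / k"]
        by (auto simp: indicator_def simp flip: ennreal_mult ennreal_plus intro!: ennreal_leI)
    qed
    also have "\<dots> = ennreal k * ennreal m +
        ennreal (k / N 1) * (\<integral>\<^sup>+\<omega>. ennreal (N (\<bar>\<xi> \<omega>\<bar> / k)) \<partial>M)"
      using m by (simp add: nn_integral_add nn_integral_cmult nn_integral_cmult_indicator)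
    also have "\<dots> \<le> ennreal k * ennreal m + ennreal (k / N 1) * 1"
      using k by (intro add_mono mult_left_mono) (auto simp: luxemburg_set_def)
    also have "\<dots> = ennreal (C * nrm \<xi>)"
      using k m N1 by (simp flip: ennreal_mult ennreal_plus add: C_def k_def[symmetric] algebra_simps)
    finally show ?thesis .
  qed
  moreover have "0 \<le> C" using m N1 by (simp add: C_def)
  ultimately show ?thesis by blast
qed

lemma luxemburg_ri_space: "ri_space M Or nrm"
  unfolding ri_space_def
proof (intro conjI ballI impI)
  fix \<xi> \<eta> assume "\<xi> \<in> Or" "\<eta> \<in> borel_measurable M" "equimeasurable M \<xi> \<eta>"
  then show "\<eta> \<in> Or"
    using luxemburg_set_equimeasurable[of \<xi> \<eta>] by (simp add: orlicz_space_def)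
next
  show "complete_norm Or nrm"
    by (rule complete_normI_fatou[OF orlicz_space_ideal luxemburg_ri_norm luxemburg_fatou
          luxemburg_norm_local_integrable])
qed (simp_all add: orlicz_space_ideal luxemburg_ri_norm luxemburg_fatou
    indicator_in_orlicz_space luxemburg_norm_local_integrable)

end

section \<open>The Luxemburg norm and its equivalent norms\<close>

theorem theorem3p1:
  fixes M :: "'a measure" and N :: "real \<Rightarrow> real"
  assumes "sigma_finite_measure M"
    and "emeasure M (space M) \<noteq> 0"
    and "diffuse_measure M"
    and "young_function N"
    and "continuous_on {0..} N"
    and "strict_mono_on {0..} N"
  shows "ri_space M (orlicz_space M N) (luxemburg_norm M N) \<and>
    regular_ri M (orlicz_space M N) (luxemburg_norm M N) \<and>
    (\<forall>nrm'. ri_norm M (orlicz_space M N) nrm' \<and>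
        equivalent_norms (orlicz_space M N) (luxemburg_norm M N) nrm' \<longrightarrow>
        weakly_regular_ri M (orlicz_space M N) nrm')"
proof -
  interpret sigma_finite_measure M by fact
  interpret orlicz M N by standard fact+
  have regular: "regular_ri M Or nrm'" if ri: "ri_norm M Or nrm'"
    and small: "\<And>e. e > 0 \<Longrightarrow>
      \<exists>d>0. \<forall>E\<in>sets M. emeasure M E \<le> ennreal d \<longrightarrow> nrm' (indicat_real E) \<le> e" for nrm'
    by (rule ri_norm_regular[OF assms(3,2) ri orlicz_space_ideal indicator_in_orlicz_space small])
  have "weakly_regular_ri M Or nrm'"
    if ri: "ri_norm M Or nrm'" and equiv: "equivalent_norms Or nrm nrm'" for nrm'
  proof -
    obtain C where C: "0 < C" "\<And>\<xi>. \<xi> \<in> Or \<Longrightarrow> nrm' \<xi> \<le> C * nrm \<xi>"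
      using equiv unfolding equivalent_norms_def by blast
    \<comment> \<open>The upper bound by \<open>C * nrm\<close> transfers smallness of indicators,
      with e / C in place of e; the order and rearrangement properties of \<open>nrm'\<close> are
      those of \<open>ri_norm\<close>.\<close>
    have "regular_ri M Or nrm'"
    proof (rule regular[OF ri])
      fix e :: real assume e: "0 < e"
      then obtain d where d: "0 < d"
          "\<forall>E\<in>sets M. emeasure M E \<le> ennreal d \<longrightarrow> nrm (indicat_real E) \<le> e / C"
        using luxemburg_norm_indicator_small[of "e / C"] C(1) by auto
      have "nrm' (indicat_real E) \<le> e" if E: "E \<in> sets M" "emeasure M E \<le> ennreal d" for E
      proof -
        have "emeasure M E < \<infinity>" using E(2) by (auto simp: less_top[symmetric] top_unique)
        then have "nrm' (indicat_real E) \<le> C * nrm (indicat_real E)"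
          using E(1) by (intro C indicator_in_orlicz_space)
        also have "\<dots> \<le> C * (e / C)"
          using C(1) d(2) E by (intro mult_left_mono) auto
        finally show ?thesis using C(1) by simp
      qed
      with d(1) show "\<exists>d>0. \<forall>E\<in>sets M. emeasure M E \<le> ennreal d \<longrightarrow> nrm' (indicat_real E) \<le> e"
        by blast
    qed
    then show ?thesis by (rule regular_ri_imp_weakly_regular_ri)
  qed
  moreover have "ri_space M Or nrm"
    by (rule luxemburg_ri_space)
  moreover have "regular_ri M Or nrm"
    using regular[OF luxemburg_ri_norm luxemburg_norm_indicator_small] .
  ultimately show ?thesis by blast
qed

end
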